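(* Let $\mathcal{T}$ be a spherically symmetric rooted tree and let $G$ be a saturated weakly branch group on $\mathcal{T}$. Suppose that every element of the outer automorphism group $\operatorname{Out}(G)$ has finite order. Then $G$ has the property $R_\infty$.
   Context: A rooted tree $\mathcal{T}$ is spherically symmetric if all vertices of the same level have the same (finite) number of immediate descendants. $L_n$ denotes the $n$-th level of $\mathcal{T}$ and $\mathcal{T}_v$ the subtree with root vertex $v$ consisting of $v$ and all its descendants. Groups act on $\mathcal{T}$ by automorphisms (isometries) of the rooted tree. A group $G$ acting faithfully on $\mathcal{T}$ is a weakly branch group if for every vertex $v$ of $\mathcal{T}$ there exists an element of $G$ which acts nontrivially on $\mathcal{T}_v$ and trivially outside $\mathcal{T}_v$. $G$ is saturated if for every positive integer $n$ there exists a characteristic subgroup $H_n\subset G$ which acts trivially on $L_n$ and acts level transitively (i.e. transitively on each level) on every subtree $\mathcal{T}_v$ with $v\in L_n$. For an automorphism $\phi:G\to G$, the Reidemeister number $R(\phi)$ is the number of equivalence classes of the relation $g\sim hg\phi(h^{-1})$, $g,h\in G$. $G$ has the property $R_\infty$ (is an $R_\infty$ group) if $R(\phi)=\infty$ for every automorphism $\phi$ of $G$. $\operatorname{Out}(G)=\operatorname{Aut}(G)/\operatorname{Inn}(G)$. *)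

theory Defs
  imports "HOL-Algebra.Algebra" "HOL-Library.Extended_Nat"
begin

section \<open>Rooted trees\<close>

text \<open>
  A rooted tree is given by its vertex set \<open>V\<close>, its root \<open>r\<close> and the relation \<open>E\<close> of pairs
  (vertex, immediate descendant), i.e. all edges are directed away from the root.
\<close>

locale rooted_tree =
  fixes V :: "'v set" and E :: "('v \<times> 'v) set" and r :: 'v
  assumes root_in: "r \<in> V"
    and edges_in: "E \<subseteq> V \<times> V"
    and root_no_parent: "(u, r) \<notin> E"
    and unique_parent: "(u, w) \<in> E \<Longrightarrow> (u', w) \<in> E \<Longrightarrow> u = u'"
    and reachable: "v \<in> V \<Longrightarrow> (r, v) \<in> E\<^sup>*"

definition subtree :: "('v \<times> 'v) set \<Rightarrow> 'v \<Rightarrow> 'v set" where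
  "subtree E v = E\<^sup>* `` {v}"

text \<open>
  The \<open>n\<close>-th level of the subtree with root \<open>v\<close>, counted from \<open>v\<close>; the \<open>n\<close>-th level of the whole
  tree is \<open>level E r n\<close>.
\<close>

definition level :: "('v \<times> 'v) set \<Rightarrow> 'v \<Rightarrow> nat \<Rightarrow> 'v set" where
  "level E v n = (E ^^ n) `` {v}"

definition tree_automorphism :: "'v set \<Rightarrow> ('v \<times> 'v) set \<Rightarrow> 'v \<Rightarrow> ('v \<Rightarrow> 'v) \<Rightarrow> bool" where
  "tree_automorphism V E r f \<longleftrightarrow>
     bij_betw f V V \<and> f r = r \<and> (\<forall>u\<in>V. \<forall>w\<in>V. (u, w) \<in> E \<longleftrightarrow> (f u, f w) \<in> E)"

locale spherically_symmetric_tree = rooted_tree V E r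
  for V :: "'v set" and E and r +
  assumes spherically_symmetric:
    "\<exists>m. \<forall>v \<in> level E r n. finite (E `` {v}) \<and> card (E `` {v}) = m"


section \<open>Groups acting on rooted trees\<close>

locale weakly_branch_group = rooted_tree V E r + faithful_action G V \<phi>
  for V :: "'v set" and E and r and G :: "('a, 'b) monoid_scheme" (structure) and \<phi> +
  assumes automorphisms: "g \<in> carrier G \<Longrightarrow> tree_automorphism V E r (\<phi> g)"
    and weakly_branch:
      "v \<in> V \<Longrightarrow> \<exists>g \<in> carrier G. (\<exists>w \<in> subtree E v. \<phi> g w \<noteq> w) \<and>
                                (\<forall>w \<in> V - subtree E v. \<phi> g w = w)"

definition characteristic_subgroup :: "'a set \<Rightarrow> ('a, 'b) monoid_scheme \<Rightarrow> bool" where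
  "characteristic_subgroup H G \<longleftrightarrow> subgroup H G \<and> (\<forall>\<psi> \<in> auto G. \<psi> ` H = H)"

text \<open>
  If \<open>H\<close> fixes \<open>v\<close>, then it acts on the subtree with root \<open>v\<close>, and the following says that this
  action is transitive on each of its levels.
\<close>

definition level_transitive_on_subtree ::
  "('v \<times> 'v) set \<Rightarrow> 'v \<Rightarrow> 'a set \<Rightarrow> ('a \<Rightarrow> 'v \<Rightarrow> 'v) \<Rightarrow> bool" where
  "level_transitive_on_subtree E v H \<phi> \<longleftrightarrow>
     (\<forall>k. \<forall>w \<in> level E v k. \<forall>w' \<in> level E v k. \<exists>h \<in> H. \<phi> h w = w')"

definition saturated ::
  "('v \<times> 'v) set \<Rightarrow> 'v \<Rightarrow> ('a, 'b) monoid_scheme \<Rightarrow> ('a \<Rightarrow> 'v \<Rightarrow> 'v) \<Rightarrow> bool" where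
  "saturated E r G \<phi> \<longleftrightarrow>
     (\<forall>n::nat. 0 < n \<longrightarrow>
        (\<exists>H. characteristic_subgroup H G \<and>
             (\<forall>h \<in> H. \<forall>v \<in> level E r n. \<phi> h v = v) \<and>
             (\<forall>v \<in> level E r n. level_transitive_on_subtree E v H \<phi>)))"


section \<open>Outer automorphisms\<close>

definition inner_automorphisms :: "('a, 'b) monoid_scheme \<Rightarrow> ('a \<Rightarrow> 'a) set" where
  "inner_automorphisms G =
     (\<lambda>g. \<lambda>x \<in> carrier G. g \<otimes>\<^bsub>G\<^esub> x \<otimes>\<^bsub>G\<^esub> inv\<^bsub>G\<^esub> g) ` carrier G"

definition OutGroup :: "('a, 'b) monoid_scheme \<Rightarrow> ('a \<Rightarrow> 'a) set monoid" where
  "OutGroup G = AutoGroup G Mod inner_automorphisms G"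


section \<open>Twisted conjugacy\<close>

definition twisted_conj :: "('a, 'b) monoid_scheme \<Rightarrow> ('a \<Rightarrow> 'a) \<Rightarrow> ('a \<times> 'a) set" where
  "twisted_conj G \<psi> =
     {(g, g'). g \<in> carrier G \<and> g' \<in> carrier G \<and>
               (\<exists>h \<in> carrier G. g' = h \<otimes>\<^bsub>G\<^esub> g \<otimes>\<^bsub>G\<^esub> \<psi> (inv\<^bsub>G\<^esub> h))}"

definition reidemeister_number :: "('a, 'b) monoid_scheme \<Rightarrow> ('a \<Rightarrow> 'a) \<Rightarrow> enat" where
  "reidemeister_number G \<psi> =
     (let C = carrier G // twisted_conj G \<psi> in if finite C then enat (card C) else \<infinity>)"

definition R_infinity :: "('a, 'b) monoid_scheme \<Rightarrow> bool" where
  "R_infinity G \<longleftrightarrow> (\<forall>\<psi> \<in> auto G. reidemeister_number G \<psi> = \<infinity>)"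


section \<open>Well-definedness\<close>

context group
begin

lemma auto_closed: "\<psi> \<in> auto G \<Longrightarrow> x \<in> carrier G \<Longrightarrow> \<psi> x \<in> carrier G"
  by (auto simp: auto_def hom_def)

lemma auto_group_hom: "\<psi> \<in> auto G \<Longrightarrow> group_hom G G \<psi>"
  by (simp add: auto_def group_hom_def group_hom_axioms_def is_group)

lemma equiv_twisted_conj:
  assumes "\<psi> \<in> auto G"
  shows "equiv (carrier G) (twisted_conj G \<psi>)"
proof -
  interpret \<psi>: group_hom G G \<psi> by (rule auto_group_hom[OF assms])
  show ?thesis
  proof (rule equivI)
    show "twisted_conj G \<psi> \<subseteq> carrier G \<times> carrier G"
      by (auto simp: twisted_conj_def)
    show "refl_on (carrier G) (twisted_conj G \<psi>)"
      by (rule refl_onI) (auto simp: twisted_conj_def intro!: bexI[of _ \<one>])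
    show "sym (twisted_conj G \<psi>)"
    proof (rule symI)
      fix g g' assume "(g, g') \<in> twisted_conj G \<psi>"
      then obtain h where h: "h \<in> carrier G" "g \<in> carrier G" "g' \<in> carrier G"
        "g' = h \<otimes> g \<otimes> \<psi> (inv h)" unfolding twisted_conj_def by blast
      have "g = inv h \<otimes> g' \<otimes> \<psi> (inv (inv h))"
        using h(1,2) unfolding h(4) by (simp add: m_assoc inv_solve_left)
      with h show "(g', g) \<in> twisted_conj G \<psi>" unfolding twisted_conj_def by blast
    qed
    show "trans (twisted_conj G \<psi>)"
    proof (rule transI)
      fix g g' g'' assume a: "(g, g') \<in> twisted_conj G \<psi>" "(g', g'') \<in> twisted_conj G \<psi>"
      obtain h where h: "h \<in> carrier G" "g \<in> carrier G" "g' = h \<otimes> g \<otimes> \<psi> (inv h)"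
        using a(1) unfolding twisted_conj_def by blast
      obtain k where k: "k \<in> carrier G" "g'' \<in> carrier G" "g'' = k \<otimes> g' \<otimes> \<psi> (inv k)"
        using a(2) unfolding twisted_conj_def by blast
      have "g'' = (k \<otimes> h) \<otimes> g \<otimes> \<psi> (inv (k \<otimes> h))"
        using h(1,2) k(1) unfolding k(3) h(3) by (simp add: m_assoc inv_mult_group)
      with h(2) k(2) show "(g, g'') \<in> twisted_conj G \<psi>"
        unfolding twisted_conj_def using m_closed[OF k(1) h(1)] by blast
    qed
  qed
qed

lemma cancel_inv:
  assumes "g \<in> carrier G" "x \<in> carrier G"
  shows "g \<otimes> (inv g \<otimes> x) = x" "inv g \<otimes> (g \<otimes> x) = x"
  using assms by (simp_all add: m_assoc[symmetric])

lemma conj_in_auto: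
  assumes "g \<in> carrier G"
  shows "(\<lambda>x \<in> carrier G. g \<otimes> x \<otimes> inv g) \<in> auto G"
proof -
  let ?c = "\<lambda>x \<in> carrier G. g \<otimes> x \<otimes> inv g"
  have "bij_betw ?c (carrier G) (carrier G)"
    by (rule bij_betw_byWitness[where f' = "\<lambda>x. inv g \<otimes> x \<otimes> g"])
       (use assms in \<open>auto simp: m_assoc cancel_inv\<close>)
  moreover have "?c \<in> hom G G"
    using assms by (auto simp: hom_def m_assoc cancel_inv)
  ultimately show ?thesis by (simp add: auto_def Bij_def)
qed

lemma AutoGroup_simps:
  "carrier (AutoGroup G) = auto G"
  "\<one>\<^bsub>AutoGroup G\<^esub> = (\<lambda>x \<in> carrier G. x)"
  "\<alpha> \<in> auto G \<Longrightarrow> \<beta> \<in> auto G \<Longrightarrow> \<alpha> \<otimes>\<^bsub>AutoGroup G\<^esub> \<beta> = compose (carrier G) \<alpha> \<beta>"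
  by (auto simp: AutoGroup_def BijGroup_def auto_def)

lemma group_hom_conj:
  "group_hom G (AutoGroup G) (\<lambda>g. \<lambda>x \<in> carrier G. g \<otimes> x \<otimes> inv g)"
proof -
  have "(\<lambda>g. \<lambda>x \<in> carrier G. g \<otimes> x \<otimes> inv g) \<in> hom G (AutoGroup G)"
  proof (rule homI)
    fix g h assume "g \<in> carrier G" "h \<in> carrier G"
    then show "(\<lambda>x \<in> carrier G. (g \<otimes> h) \<otimes> x \<otimes> inv (g \<otimes> h)) =
      (\<lambda>x \<in> carrier G. g \<otimes> x \<otimes> inv g) \<otimes>\<^bsub>AutoGroup G\<^esub> (\<lambda>x \<in> carrier G. h \<otimes> x \<otimes> inv h)"
      by (auto simp: AutoGroup_simps conj_in_auto compose_def fun_eq_iff m_assoc inv_mult_group)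
  qed (simp add: AutoGroup_simps conj_in_auto)
  then show ?thesis
    by (simp add: group_hom_def group_hom_axioms_def is_group AutoGroup)
qed

lemma inner_automorphisms_normal: "inner_automorphisms G \<lhd> AutoGroup G"
proof -
  interpret A: group "AutoGroup G" by (rule AutoGroup)
  have sub: "subgroup (inner_automorphisms G) (AutoGroup G)"
    unfolding inner_automorphisms_def by (rule group_hom.img_is_subgroup[OF group_hom_conj])
  show ?thesis
  proof (rule A.normal_invI[OF sub])
    fix \<psi> \<iota> assume \<psi>: "\<psi> \<in> carrier (AutoGroup G)" and "\<iota> \<in> inner_automorphisms G"
    then obtain g where g: "g \<in> carrier G" "\<iota> = (\<lambda>x \<in> carrier G. g \<otimes> x \<otimes> inv g)"
      by (auto simp: inner_automorphisms_def)
    have \<psi>': "\<psi> \<in> auto G" using \<psi> by (simp add: AutoGroup_simps)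
    interpret \<psi>: group_hom G G \<psi> by (rule auto_group_hom[OF \<psi>'])
    let ?\<kappa> = "\<lambda>x \<in> carrier G. \<psi> g \<otimes> x \<otimes> inv \<psi> g"
    have \<kappa>: "?\<kappa> \<in> auto G" using g by (simp add: conj_in_auto)
    have \<iota>: "\<iota> \<in> auto G" using g by (simp add: conj_in_auto)
    have "\<psi> \<otimes>\<^bsub>AutoGroup G\<^esub> \<iota> = ?\<kappa> \<otimes>\<^bsub>AutoGroup G\<^esub> \<psi>"
      unfolding AutoGroup_simps(3)[OF \<psi>' \<iota>] AutoGroup_simps(3)[OF \<kappa> \<psi>']
      using g(1) by (auto simp: compose_def fun_eq_iff g(2))
    then have "\<psi> \<otimes>\<^bsub>AutoGroup G\<^esub> \<iota> \<otimes>\<^bsub>AutoGroup G\<^esub> inv\<^bsub>AutoGroup G\<^esub> \<psi> = ?\<kappa>"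
      using \<psi> \<kappa> A.inv_solve_right'[of ?\<kappa>] by (simp add: A.m_assoc AutoGroup_simps(1)[symmetric])
    moreover have "?\<kappa> \<in> inner_automorphisms G"
      using g(1) by (auto simp: inner_automorphisms_def)
    ultimately show "\<psi> \<otimes>\<^bsub>AutoGroup G\<^esub> \<iota> \<otimes>\<^bsub>AutoGroup G\<^esub> inv\<^bsub>AutoGroup G\<^esub> \<psi> \<in> inner_automorphisms G"
      by simp
  qed
qed

lemma group_OutGroup: "group (OutGroup G)"
  unfolding OutGroup_def by (rule normal.factorgroup_is_group[OF inner_automorphisms_normal])

end

end

theory Submission
  imports Defs
begin

text \<open>
  Let \<open>\<psi>\<close> be an automorphism of \<open>G\<close>. Some power \<open>\<psi> ^^ n\<close> is inner. Write \<open>\<xi>\<^sub>x\<close> for \<open>\<psi>\<close> followed by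
  conjugation with \<open>x\<close>. Replacing \<open>x\<close> by a twisted conjugate conjugates \<open>\<xi>\<^sub>x\<close> by an inner
  automorphism, so the twisted classes of \<open>\<psi>\<close> are the orbits of this action on the coset of
  \<open>\<psi>\<close> modulo inner automorphisms. Suppose that there are only finitely many of them.

  \<^bold>\<open>From finitely many classes to a coset of bounded order.\<close> The elements \<open>g\<close> such that all
  \<open>\<psi>\<close>-iterates of \<open>g\<close> fix the levels up to \<open>m\<close> form a normal subgroup \<open>K m\<close> that is invariant
  under \<open>\<psi>\<close>. It has finite index because the levels are finite and \<open>\<psi> ^^ n\<close> is inner, and the
  \<open>K m\<close> intersect trivially because the action is faithful. If a coset of
  some \<open>K m\<close> meets as few classes as possible, then every class that meets it is dense in it
  (\<open>dense_twisted_class\<close>). Let \<open>x\<close> be an element of such a coset. As \<open>\<psi> ^^ n\<close> is inner, \<open>\<xi>\<^sub>x ^^ n\<close> is conjugation by an element \<open>z\<close>, and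
  \<open>\<xi>\<^sub>x z = z\<close>: thus all powers of \<open>z\<close> lie in the twisted stabilizer of \<open>x\<close>. In every quotient
  \<open>G / K m'\<close> the twisted class of \<open>x\<close> contains a coset of \<open>K m / K m'\<close>, so orbit counting bounds its
  stabilizer by the index of \<open>K m\<close>, whatever \<open>m'\<close> is (\<open>fixed_power_in_filtration\<close>). Hence \<open>z\<close> has
  finite order, the order of \<open>\<xi>\<^sub>x\<close> divides some \<open>M > 0\<close>, and by density \<open>\<xi>\<^sub>y ^^ M\<close> is the identity for
  \<open>y = h x\<close> with any \<open>h \<in> K m\<close>.

  \<^bold>\<open>No coset has bounded order.\<close> The rigid stabilizers of vertices, cut down to \<open>K m\<close>, are
  nontrivial subgroups normalized by \<open>K m\<close>. Such local subgroups, and their images under all \<open>\<xi>\<^sub>y\<close>, play the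
  role of pieces of the tree, with ``disjoint'' replaced by ``commuting elementwise''. No local subgroup
  commutes with itself, so if \<open>\<xi>\<^sub>y ^^ M\<close> is the identity, then a local subgroup \<open>A\<close> that commutes with
  \<open>\<xi>\<^sub>y A, ..., \<xi>\<^sub>y ^^ (l - 1) A\<close> forces \<open>l \<le> M\<close>. Take \<open>l\<close> maximal, over all \<open>y\<close> in the coset and all
  \<open>A\<close>. Maximality makes \<open>\<xi>\<^sub>y ^^ l\<close> the identity on \<open>A\<close>: if it moved an element \<open>a\<close> to \<open>b \<noteq> a\<close>, then \<open>a\<close>
  and \<open>b\<close> would differ at a vertex \<open>w\<close>, and a translate of a piece of the rigid stabilizer of \<open>w\<close> would commute
  with its image and so wander longer (\<open>auto_trivial_on_local_subgroup\<close>). But with \<open>u y\<close> in place of \<open>y\<close>, where \<open>u \<in> A\<close>,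
  the \<open>l\<close>-th iterate acts on \<open>A\<close> as conjugation by \<open>u\<close>, and it has to be the identity as well.
  Hence \<open>A\<close> is abelian, which is impossible (\<open>no_coset_of_bounded_order\<close>).
\<close>

section \<open>Local subgroups of a filtered group\<close>

definition elementwise_commute :: "('a, 'b) monoid_scheme \<Rightarrow> 'a set \<Rightarrow> 'a set \<Rightarrow> bool" where
  "elementwise_commute G A B \<longleftrightarrow> (\<forall>a \<in> A. \<forall>b \<in> B. a \<otimes>\<^bsub>G\<^esub> b = b \<otimes>\<^bsub>G\<^esub> a)"

definition conj_set :: "('a, 'b) monoid_scheme \<Rightarrow> 'a \<Rightarrow> 'a set \<Rightarrow> 'a set" where
  "conj_set G g A = (\<lambda>a. g \<otimes>\<^bsub>G\<^esub> a \<otimes>\<^bsub>G\<^esub> inv\<^bsub>G\<^esub> g) ` A"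

definition normalized_by :: "('a, 'b) monoid_scheme \<Rightarrow> 'a set \<Rightarrow> 'a set \<Rightarrow> bool" where
  "normalized_by G N A \<longleftrightarrow> (\<forall>k \<in> N. \<forall>a \<in> A. k \<otimes>\<^bsub>G\<^esub> a \<otimes>\<^bsub>G\<^esub> inv\<^bsub>G\<^esub> k \<in> A)"

text \<open>
  The automorphisms in the coset of \<open>\<psi>\<close> modulo inner automorphisms, indexed by group elements.
\<close>

definition inner_twist :: "('a, 'b) monoid_scheme \<Rightarrow> ('a \<Rightarrow> 'a) \<Rightarrow> 'a \<Rightarrow> 'a \<Rightarrow> 'a" where
  "inner_twist G \<psi> x = (\<lambda>g. x \<otimes>\<^bsub>G\<^esub> \<psi> g \<otimes>\<^bsub>G\<^esub> inv\<^bsub>G\<^esub> x)"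

lemma elementwise_commute_mono:
  "elementwise_commute G A B \<Longrightarrow> A' \<subseteq> A \<Longrightarrow> B' \<subseteq> B \<Longrightarrow> elementwise_commute G A' B'"
  unfolding elementwise_commute_def by blast

lemma (in group) cancel_inv_right:
  assumes "g \<in> carrier G" "x \<in> carrier G"
  shows "x \<otimes> g \<otimes> inv g = x" "x \<otimes> inv g \<otimes> g = x"
  using assms by (simp_all add: m_assoc)

lemmas (in group) group_simps = m_assoc cancel_inv inv_mult_group

lemma (in group) rcos_eq_iff:
  assumes "subgroup H G" "g \<in> carrier G" "h \<in> carrier G"
  shows "H #> g = H #> h \<longleftrightarrow> g \<otimes> inv h \<in> H"
  using assms rcos_self repr_independence subgroup.rcos_module[OF assms(1) is_group] by metis

lemma (in group) rcos_eq_mult: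
  assumes "subgroup H G" "k \<in> H" "g \<in> carrier G"
  shows "H #> (k \<otimes> g) = H #> g"
proof -
  have "k \<in> carrier G" using assms subgroup.mem_carrier by metis
  then show ?thesis using assms by (simp add: rcos_eq_iff cancel_inv_right)
qed

locale filtered_group = group G for G (structure) +
  fixes K :: "nat \<Rightarrow> 'a set"
  assumes K_normal: "K m \<lhd> G"
    and K_antimono: "m \<le> m' \<Longrightarrow> K m' \<subseteq> K m"
begin

lemma K_subgroup: "subgroup (K m) G"
  using K_normal by (rule normal_imp_subgroup)

lemma K_carrier: "k \<in> K m \<Longrightarrow> k \<in> carrier G"
  using K_subgroup subgroup.mem_carrier by metis

lemma K_conj: "g \<in> carrier G \<Longrightarrow> k \<in> K m \<Longrightarrow> g \<otimes> k \<otimes> inv g \<in> K m"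
  using K_normal normal.inv_op_closed2 by metis

definition filtered_auto :: "('a \<Rightarrow> 'a) \<Rightarrow> bool" where
  "filtered_auto \<eta> \<longleftrightarrow> \<eta> \<in> hom G G \<and> bij_betw \<eta> (carrier G) (carrier G) \<and> (\<forall>m. \<eta> ` K m = K m)"

lemma filtered_auto_hom:
  assumes "filtered_auto \<eta>"
  shows "group_hom G G \<eta>"
  using assms by (auto simp: filtered_auto_def group_hom_def group_hom_axioms_def is_group)

lemma filtered_auto_inj: "filtered_auto \<eta> \<Longrightarrow> a \<in> carrier G \<Longrightarrow> b \<in> carrier G \<Longrightarrow> \<eta> a = \<eta> b \<Longrightarrow> a = b"
  by (auto simp: filtered_auto_def bij_betw_def dest: inj_onD)

lemma filtered_auto_funpow:
  assumes "filtered_auto \<eta>"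
  shows "filtered_auto (\<eta> ^^ n)"
proof (induction n)
  case 0
  then show ?case by (auto simp: filtered_auto_def hom_def bij_betw_def)
next
  case (Suc n)
  note D = Suc[unfolded filtered_auto_def] assms[unfolded filtered_auto_def]
  have "\<eta> \<circ> (\<eta> ^^ n) \<in> hom G G"
    by (rule Group.hom_compose[of _ G G]) (use D in simp_all)
  moreover have "bij_betw (\<eta> \<circ> (\<eta> ^^ n)) (carrier G) (carrier G)"
    by (rule bij_betw_trans[of _ _ "carrier G"]) (use D in simp_all)
  moreover have "(\<eta> ^^ Suc n) ` K m = K m" for m
    using D unfolding funpow.simps image_comp[symmetric] by simp
  ultimately show ?case unfolding filtered_auto_def by simp
qed

lemma filtered_auto_twist:
  assumes "filtered_auto \<psi>" and x: "x \<in> carrier G"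
  shows "filtered_auto (inner_twist G \<psi> x)"
proof -
  interpret \<psi>: group_hom G G \<psi> by (rule filtered_auto_hom[OF assms(1)])
  have c: "bij_betw (\<lambda>g. x \<otimes> g \<otimes> inv x) S S"
    if "S \<subseteq> carrier G" "\<And>g s. g \<in> carrier G \<Longrightarrow> s \<in> S \<Longrightarrow> g \<otimes> s \<otimes> inv g \<in> S" for S
    by (rule bij_betw_byWitness[where f' = "\<lambda>g. inv x \<otimes> g \<otimes> x"])
       (use x that(1) that(2)[of x] that(2)[of "inv x"] in \<open>auto simp: group_simps subset_iff\<close>)
  have t: "inner_twist G \<psi> x = (\<lambda>g. x \<otimes> g \<otimes> inv x) \<circ> \<psi>" by (auto simp: inner_twist_def)
  have "inner_twist G \<psi> x \<in> hom G G"
    using x by (auto simp: hom_def inner_twist_def group_simps)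
  moreover have "bij_betw (inner_twist G \<psi> x) (carrier G) (carrier G)"
    unfolding t using c[of "carrier G"] assms(1) x
    by (intro bij_betw_trans[of \<psi>]) (auto simp: filtered_auto_def)
  moreover have "inner_twist G \<psi> x ` K m = K m" for m
  proof -
    have "inner_twist G \<psi> x ` K m = (\<lambda>g. x \<otimes> g \<otimes> inv x) ` K m"
      unfolding t image_comp[symmetric] using assms(1) by (simp add: filtered_auto_def)
    also have "\<dots> = K m"
      using c[of "K m", OF _ K_conj] K_carrier unfolding bij_betw_def by blast
    finally show ?thesis .
  qed
  ultimately show ?thesis by (simp add: filtered_auto_def)
qed

text \<open>
  The normal subgroups of \<open>K m\<close> replace subsets of the tree: they are mapped to each other by every
  automorphism that preserves the filtration, whereas a description in terms of vertices would need
  the automorphism to come from the tree. Passing to larger \<open>m\<close> allows smaller pieces.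
\<close>

definition local_subgroup :: "nat \<Rightarrow> 'a set \<Rightarrow> bool" where
  "local_subgroup m A \<longleftrightarrow>
     subgroup A G \<and> A \<subseteq> K m \<and> A \<noteq> {\<one>} \<and> normalized_by G (K m) A"

lemma local_subgroupD:
  assumes "local_subgroup m A"
  shows "subgroup A G" "A \<subseteq> K m" "\<exists>a \<in> A. a \<noteq> \<one>" "normalized_by G (K m) A"
  using assms subgroup.one_closed unfolding local_subgroup_def by blast+

lemma local_subgroup_image:
  assumes A: "local_subgroup m A" and \<eta>: "filtered_auto \<eta>"
  shows "local_subgroup m (\<eta> ` A)"
proof -
  interpret \<eta>: group_hom G G \<eta> by (rule filtered_auto_hom[OF \<eta>])
  note AD = local_subgroupD[OF A]
  have AC: "a \<in> carrier G" if "a \<in> A" for a using AD(2) K_carrier that by blast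
  have sub: "\<eta> ` A \<subseteq> K m" using AD(2) \<eta> unfolding filtered_auto_def by blast
  obtain a where a: "a \<in> A" "a \<noteq> \<one>" using AD(3) by blast
  have "\<eta> a \<noteq> \<one>" using filtered_auto_inj[OF \<eta> AC[OF a(1)] one_closed] a(2) by auto
  moreover have "normalized_by G (K m) (\<eta> ` A)"
    unfolding normalized_by_def
  proof (intro ballI)
    fix k b assume "k \<in> K m" "b \<in> \<eta> ` A"
    moreover have "\<eta> ` K m = K m" using \<eta> by (simp add: filtered_auto_def)
    ultimately obtain k' a where k': "k' \<in> K m" "a \<in> A" "k = \<eta> k'" "b = \<eta> a" by blast
    have "k \<otimes> b \<otimes> inv k = \<eta> (k' \<otimes> a \<otimes> inv k')"
      unfolding k'(3,4) using K_carrier[OF k'(1)] AC[OF k'(2)] by simp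
    then show "k \<otimes> b \<otimes> inv k \<in> \<eta> ` A"
      using AD(4) k'(1,2) unfolding normalized_by_def by blast
  qed
  ultimately show ?thesis
    using \<eta>.subgroup_img_is_subgroup[OF AD(1)] sub a(1) unfolding local_subgroup_def by blast
qed

text \<open>
  Normality under \<open>K m\<close> implies normality under the smaller group \<open>K m'\<close>, so pieces of different
  depth can be intersected.
\<close>

lemma local_subgroup_Int:
  assumes A: "local_subgroup m A" and m: "m \<le> m'" and R: "local_subgroup m' R"
    and non: "\<exists>c \<in> A \<inter> R. c \<noteq> \<one>"
  shows "local_subgroup m' (A \<inter> R)"
proof -
  have "normalized_by G (K m') (A \<inter> R)"
    using local_subgroupD(4)[OF A] local_subgroupD(4)[OF R] K_antimono[OF m]
    unfolding normalized_by_def by blast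
  then show ?thesis
    using local_subgroupD[OF A] local_subgroupD[OF R] subgroups_Inter_pair non
    unfolding local_subgroup_def by blast
qed

text \<open>
  Two local subgroups normalize each other, so their intersection contains all commutators between
  them: pieces that do not commute overlap.
\<close>

lemma local_subgroup_Int_noncommuting:
  assumes A: "local_subgroup m A" and B: "local_subgroup m B"
    and nc: "\<not> elementwise_commute G A B"
  shows "local_subgroup m (A \<inter> B)"
proof -
  obtain a b where ab: "a \<in> A" "b \<in> B" "a \<otimes> b \<noteq> b \<otimes> a"
    using nc unfolding elementwise_commute_def by blast
  have K: "a \<in> K m" "b \<in> K m" using ab local_subgroupD(2) A B by blast+
  then have C: "a \<in> carrier G" "b \<in> carrier G" using K_carrier by blast+
  interpret A: subgroup A G by (rule local_subgroupD(1)[OF A])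
  interpret B: subgroup B G by (rule local_subgroupD(1)[OF B])
  let ?c = "a \<otimes> b \<otimes> inv a \<otimes> inv b"
  have "b \<otimes> inv a \<otimes> inv b \<in> A"
    using local_subgroupD(4)[OF A] ab K unfolding normalized_by_def by blast
  then have "a \<otimes> (b \<otimes> inv a \<otimes> inv b) \<in> A" using ab by blast
  moreover have "a \<otimes> (b \<otimes> inv a \<otimes> inv b) = ?c" using C by (simp add: m_assoc)
  moreover have "?c \<in> B"
    using local_subgroupD(4)[OF B] ab K unfolding normalized_by_def by blast
  moreover have "?c \<noteq> \<one>"
  proof
    assume "?c = \<one>"
    then have "a \<otimes> b \<otimes> inv a \<otimes> inv b \<otimes> b \<otimes> a = b \<otimes> a" using C by simp
    then show False using ab(3) C by (simp add: group_simps)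
  qed
  ultimately have "\<exists>c \<in> A \<inter> B. c \<noteq> \<one>" by auto
  then show ?thesis by (rule local_subgroup_Int[OF A order.refl B])
qed

lemma local_subgroup_conj:
  assumes A: "local_subgroup m A" and g: "g \<in> carrier G"
  shows "local_subgroup m (conj_set G g A)"
proof -
  have "filtered_auto (inner_twist G (\<lambda>x. x) g)"
    by (rule filtered_auto_twist[OF _ g]) (auto simp: filtered_auto_def hom_def bij_betw_def)
  moreover have "inner_twist G (\<lambda>x. x) g ` A = conj_set G g A" by (simp add: inner_twist_def conj_set_def)
  ultimately show ?thesis using local_subgroup_image[OF A] by metis
qed

end

section \<open>Groups with enough local subgroups\<close>

text \<open>
  What is needed of the tree: \<open>R\<close> is the rigid stabilizer of a vertex \<open>w\<close>, intersected with \<open>K m\<close>, where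
  \<open>w\<close> has different images under \<open>a\<close> and \<open>b\<close>. Then the two conjugates of \<open>R\<close> sit over different vertices
  of one level, and at least one of them is not over \<open>w\<close>. The lower bound \<open>n\<close> on the depth lets \<open>R\<close>
  normalize any local subgroup given beforehand.
\<close>

locale separated_filtered_group = filtered_group G K for G (structure) and K +
  assumes nontrivial: "carrier G \<noteq> {\<one>}"
    and separation: "\<lbrakk>a \<in> carrier G; b \<in> carrier G; a \<noteq> b\<rbrakk> \<Longrightarrow>
      \<exists>m \<ge> n. \<exists>R. local_subgroup m R \<and>
        (\<forall>u \<in> R. u \<noteq> \<one> \<longrightarrow> (\<exists>v \<in> R. u \<otimes> v \<noteq> v \<otimes> u)) \<and>
        elementwise_commute G (conj_set G a R) (conj_set G b R) \<and>
        (elementwise_commute G (conj_set G a R) R \<or> elementwise_commute G (conj_set G b R) R)"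
begin

lemma separation_one:
  assumes "a \<in> carrier G" "a \<noteq> \<one>"
  obtains m R where "m \<ge> n" "local_subgroup m R"
     "\<And>u. u \<in> R \<Longrightarrow> u \<noteq> \<one> \<Longrightarrow> \<exists>v \<in> R. u \<otimes> v \<noteq> v \<otimes> u"
     "elementwise_commute G (conj_set G a R) R"
proof -
  have "conj_set G \<one> R = R" if "R \<subseteq> carrier G" for R
    using that by (force simp: conj_set_def)
  then show ?thesis
    using separation[OF assms(1) one_closed assms(2), of n] that
      local_subgroupD(1) subgroup.subset by metis
qed

text \<open>
  If \<open>a\<close> moves \<open>R\<close> to a piece that commutes with it, the commutators of \<open>a\<close> with \<open>R\<close> act on \<open>R\<close> like
  \<open>R\<close> itself. If they commuted with each other, the commutators of \<open>R\<close> would coincide with elements of the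
  conjugate of \<open>R\<close>; they would be central in \<open>R\<close>, hence trivial, and \<open>R\<close> would be abelian.
\<close>

lemma commuting_commutators_impossible:
  assumes R: "local_subgroup m R"
    and cl: "\<And>u. u \<in> R \<Longrightarrow> u \<noteq> \<one> \<Longrightarrow> \<exists>v \<in> R. u \<otimes> v \<noteq> v \<otimes> u"
    and e: "elementwise_commute G (conj_set G a R) R" and a: "a \<in> carrier G"
    and comm: "\<And>u v. u \<in> R \<Longrightarrow> v \<in> R \<Longrightarrow>
      a \<otimes> u \<otimes> inv a \<otimes> inv u \<otimes> (a \<otimes> v \<otimes> inv a \<otimes> inv v) =
      a \<otimes> v \<otimes> inv a \<otimes> inv v \<otimes> (a \<otimes> u \<otimes> inv a \<otimes> inv u)"
  shows False
proof -
  interpret R: subgroup R G by (rule local_subgroupD(1)[OF R])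
  obtain u where u: "u \<in> R" "u \<noteq> \<one>" using local_subgroupD(3)[OF R] by blast
  obtain v where v: "v \<in> R" "u \<otimes> v \<noteq> v \<otimes> u" using cl u by blast
  have C: "u \<in> carrier G" "v \<in> carrier G" using u v by auto
  let ?u = "a \<otimes> u \<otimes> inv a" and ?v = "a \<otimes> v \<otimes> inv a"
  have UC: "?u \<in> carrier G" "?v \<in> carrier G" using a C by auto
  have c: "x \<otimes> (a \<otimes> y \<otimes> inv a) = (a \<otimes> y \<otimes> inv a) \<otimes> x" if "x \<in> R" "y \<in> R" for x y
    using e that unfolding elementwise_commute_def conj_set_def by force
  have 1: "?u \<otimes> inv u \<otimes> (?v \<otimes> inv v) = (?u \<otimes> ?v) \<otimes> (inv u \<otimes> inv v)"
  proof -
    have "?u \<otimes> inv u \<otimes> (?v \<otimes> inv v) = ?u \<otimes> (inv u \<otimes> ?v) \<otimes> inv v"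
      using UC C by (simp only: m_assoc m_closed inv_closed)
    also have "\<dots> = ?u \<otimes> (?v \<otimes> inv u) \<otimes> inv v" using c u v by simp
    finally show ?thesis using UC C by (simp only: m_assoc m_closed inv_closed)
  qed
  have 2: "?v \<otimes> inv v \<otimes> (?u \<otimes> inv u) = (?v \<otimes> ?u) \<otimes> (inv v \<otimes> inv u)"
  proof -
    have "?v \<otimes> inv v \<otimes> (?u \<otimes> inv u) = ?v \<otimes> (inv v \<otimes> ?u) \<otimes> inv u"
      using UC C by (simp only: m_assoc m_closed inv_closed)
    also have "\<dots> = ?v \<otimes> (?u \<otimes> inv v) \<otimes> inv u" using c u v by simp
    finally show ?thesis using UC C by (simp only: m_assoc m_closed inv_closed)
  qed
  define s where "s = inv v \<otimes> inv u \<otimes> v \<otimes> u"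
  have sR: "s \<in> R" unfolding s_def using u v by auto
  have "(?u \<otimes> ?v) \<otimes> (inv u \<otimes> inv v) = (?v \<otimes> ?u) \<otimes> (inv v \<otimes> inv u)"
    using comm[OF u(1) v(1)] 1 2 by simp
  then have "inv (?v \<otimes> ?u) \<otimes> ((?u \<otimes> ?v) \<otimes> (inv u \<otimes> inv v)) \<otimes> (v \<otimes> u) =
    inv (?v \<otimes> ?u) \<otimes> ((?v \<otimes> ?u) \<otimes> (inv v \<otimes> inv u)) \<otimes> (v \<otimes> u)" by simp
  moreover have "inv (?v \<otimes> ?u) \<otimes> ((?u \<otimes> ?v) \<otimes> (inv u \<otimes> inv v)) \<otimes> (v \<otimes> u) =
    a \<otimes> (inv u \<otimes> inv v \<otimes> u \<otimes> v) \<otimes> inv a"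
    using a C by (simp add: group_simps)
  moreover have "inv (?v \<otimes> ?u) \<otimes> ((?v \<otimes> ?u) \<otimes> (inv v \<otimes> inv u)) \<otimes> (v \<otimes> u) = s"
    unfolding s_def using a C by (simp add: group_simps)
  ultimately have "a \<otimes> (inv u \<otimes> inv v \<otimes> u \<otimes> v) \<otimes> inv a = s" by simp
  moreover have "inv u \<otimes> inv v \<otimes> u \<otimes> v \<in> R" using u v by auto
  ultimately have "s \<otimes> x = x \<otimes> s" if "x \<in> R" for x using c that by metis
  then have "s = \<one>" using cl sR by blast
  then have "u \<otimes> v \<otimes> s = u \<otimes> v" using C by simp
  moreover have "u \<otimes> v \<otimes> s = v \<otimes> u" unfolding s_def using C by (simp add: group_simps)
  ultimately show False using v(2) by simp
qed

text \<open>
  A local subgroup contains the commutators of its elements with every sufficiently deep piece, and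
  these commutators do not all commute.
\<close>

lemma local_subgroup_nonabelian:
  assumes A: "local_subgroup m A"
  shows "\<not> elementwise_commute G A A"
proof
  assume ab: "elementwise_commute G A A"
  interpret A: subgroup A G by (rule local_subgroupD(1)[OF A])
  obtain a where a: "a \<in> A" "a \<noteq> \<one>" using local_subgroupD(3)[OF A] by blast
  obtain m' R where R: "m' \<ge> m" "local_subgroup m' R"
     "\<And>u. u \<in> R \<Longrightarrow> u \<noteq> \<one> \<Longrightarrow> \<exists>v \<in> R. u \<otimes> v \<noteq> v \<otimes> u"
     "elementwise_commute G (conj_set G a R) R"
    using separation_one[of a m] a by auto
  interpret R: subgroup R G by (rule local_subgroupD(1)[OF R(2)])
  have "a \<otimes> u \<otimes> inv a \<otimes> inv u \<in> A" if "u \<in> R" for u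
  proof -
    have "u \<in> K m" using that local_subgroupD(2)[OF R(2)] K_antimono[OF R(1)] by blast
    then have "u \<otimes> inv a \<otimes> inv u \<in> A"
      using local_subgroupD(4)[OF A] a unfolding normalized_by_def by blast
    then have "a \<otimes> (u \<otimes> inv a \<otimes> inv u) \<in> A" using a by blast
    then show ?thesis using a that by (simp add: m_assoc)
  qed
  then show False
    using commuting_commutators_impossible[OF R(2) R(3) R(4)] a ab
    unfolding elementwise_commute_def by auto
qed

lemma center_trivial:
  assumes z: "z \<in> carrier G" and c: "\<And>g. g \<in> carrier G \<Longrightarrow> z \<otimes> g = g \<otimes> z"
  shows "z = \<one>"
proof (rule ccontr)
  assume "z \<noteq> \<one>"
  then obtain m R where R: "local_subgroup m R" "elementwise_commute G (conj_set G z R) R"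
    using separation_one[OF z, where n = 0] by metis
  interpret R: subgroup R G by (rule local_subgroupD(1)[OF R(1)])
  have "z \<otimes> u \<otimes> inv z = u" if "u \<in> R" for u
    using z that by (simp add: c group_simps)
  then have "conj_set G z R = R" by (simp add: conj_set_def)
  then show False using local_subgroup_nonabelian[OF R(1)] R(2) by simp
qed

text \<open>
  If \<open>a \<in> A\<close> moves \<open>R\<close> off itself, then \<open>A\<close> contains the double commutators
  \<open>[[a, u], v] = [inv u, v]\<close> for \<open>u, v \<in> R\<close>, hence a nontrivial part of \<open>R\<close>. This is the classical argument
  that a normal subgroup of a branch group contains the derived subgroup of a rigid stabilizer.
\<close>

lemma local_subgroup_meets:
  assumes A: "local_subgroup m A" and a: "a \<in> A" and m: "m \<le> m'" and R: "local_subgroup m' R"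
    and e: "elementwise_commute G (conj_set G a R) R"
  shows "local_subgroup m' (A \<inter> R)"
proof -
  interpret A: subgroup A G by (rule local_subgroupD(1)[OF A])
  interpret R: subgroup R G by (rule local_subgroupD(1)[OF R])
  obtain u v where uv: "u \<in> R" "v \<in> R" "u \<otimes> v \<noteq> v \<otimes> u"
    using local_subgroup_nonabelian[OF R] unfolding elementwise_commute_def by blast
  have RK: "x \<in> K m" if "x \<in> R" for x
    using that local_subgroupD(2)[OF R] K_antimono[OF m] by blast
  have AK: "x \<otimes> y \<otimes> inv x \<in> A" if "x \<in> R" "y \<in> A" for x y
    using local_subgroupD(4)[OF A] RK that unfolding normalized_by_def by blast
  let ?u = "a \<otimes> u \<otimes> inv a"
  have C: "a \<in> carrier G" "u \<in> carrier G" "v \<in> carrier G" "?u \<in> carrier G" using a uv by auto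
  have c: "x \<otimes> ?u = ?u \<otimes> x" if "x \<in> R" for x
    using e uv(1) that unfolding elementwise_commute_def conj_set_def by force
  define b where "b = a \<otimes> (u \<otimes> inv a \<otimes> inv u)"
  have bA: "b \<in> A" unfolding b_def using AK[OF uv(1)] a by blast
  have b: "b = ?u \<otimes> inv u" unfolding b_def using C by (simp add: m_assoc)
  define d where "d = inv u \<otimes> v \<otimes> u \<otimes> inv v"
  have dR: "d \<in> R" unfolding d_def using uv by auto
  have "b \<otimes> (v \<otimes> inv b \<otimes> inv v) = d"
  proof -
    have "b \<otimes> (v \<otimes> inv b \<otimes> inv v) = ?u \<otimes> inv u \<otimes> (v \<otimes> u) \<otimes> (inv ?u \<otimes> inv v)"
      unfolding b using C by (simp only: group_simps m_closed inv_closed inv_inv)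
    also have "\<dots> = ?u \<otimes> (inv u \<otimes> (v \<otimes> u)) \<otimes> (inv ?u \<otimes> inv v)"
      using C by (simp only: m_assoc m_closed inv_closed)
    also have "\<dots> = (inv u \<otimes> (v \<otimes> u)) \<otimes> ?u \<otimes> (inv ?u \<otimes> inv v)"
      using c[of "inv u \<otimes> (v \<otimes> u)"] uv by auto
    also have "\<dots> = (inv u \<otimes> (v \<otimes> u)) \<otimes> (?u \<otimes> (inv ?u \<otimes> inv v))"
      using C by (simp only: m_assoc m_closed inv_closed)
    also have "?u \<otimes> (inv ?u \<otimes> inv v) = inv v" using C by (simp only: cancel_inv inv_closed)
    finally show ?thesis unfolding d_def using C by (simp add: m_assoc)
  qed
  then have "d \<in> A" using AK[OF uv(2), of "inv b"] bA by (metis A.m_closed A.m_inv_closed)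
  moreover have "d \<noteq> \<one>"
  proof
    assume "d = \<one>"
    then have "u \<otimes> d \<otimes> v = u \<otimes> v" using C by simp
    then show False using uv(3) C unfolding d_def by (simp add: group_simps)
  qed
  ultimately show ?thesis using local_subgroup_Int[OF A m R] dR by blast
qed

text \<open>
  Suppose that \<open>\<eta>\<close> makes no piece of \<open>A\<close> commute with its image, but moves \<open>a \<in> A\<close> to \<open>b \<noteq> a\<close>. Take \<open>R\<close>
  separating \<open>a\<close> from \<open>b\<close>. Every piece of \<open>A\<close> overlaps with its image, so there is a piece \<open>D\<close> of \<open>A\<close>
  with both \<open>D\<close> and \<open>\<eta> D\<close> inside \<open>R\<close>. Its conjugate by \<open>a\<close> is a piece of \<open>A\<close> inside
  \<open>a R inv a\<close>, while the image of that conjugate is inside \<open>b R inv b\<close>; these two commute.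
\<close>

lemma auto_trivial_on_local_subgroup:
  assumes \<eta>: "filtered_auto \<eta>" and A: "local_subgroup m A"
    and max: "\<And>m' A'. m \<le> m' \<Longrightarrow> local_subgroup m' A' \<Longrightarrow> A' \<subseteq> A \<Longrightarrow>
      \<not> elementwise_commute G A' (\<eta> ` A')"
    and a: "a \<in> A"
  shows "\<eta> a = a"
proof (rule ccontr)
  interpret A: subgroup A G by (rule local_subgroupD(1)[OF A])
  interpret \<eta>: group_hom G G \<eta> by (rule filtered_auto_hom[OF \<eta>])
  define b where "b = \<eta> a"
  assume "\<eta> a \<noteq> a"
  then have "a \<noteq> b" by (simp add: b_def)
  moreover have C: "a \<in> carrier G" "b \<in> carrier G" using a by (auto simp: b_def)
  ultimately obtain m' R where m': "m \<le> m'" and R: "local_subgroup m' R"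
    and disj: "elementwise_commute G (conj_set G a R) (conj_set G b R)"
    and moved: "elementwise_commute G (conj_set G a R) R \<or> elementwise_commute G (conj_set G b R) R"
    using separation[of a b m] by blast
  have overlap: "local_subgroup m' (B \<inter> \<eta> ` B)" if "local_subgroup m' B" "B \<subseteq> A" for B
    using local_subgroup_Int_noncommuting[OF that(1) local_subgroup_image[OF that(1) \<eta>]]
      max[OF m' that] by blast
  have preimage: "local_subgroup m' {x \<in> A. \<eta> x \<in> B}"
    if B: "local_subgroup m' B" "B \<subseteq> \<eta> ` A" for B
  proof -
    note BD = local_subgroupD[OF B(1)]
    interpret B: subgroup B G by (rule BD(1))
    let ?P = "{x \<in> A. \<eta> x \<in> B}"
    have "\<one> \<in> ?P" by simp
    then have "?P \<noteq> {}" by blast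
    then have "subgroup ?P G" by (rule subgroupI[rotated]) auto
    moreover have "?P \<subseteq> K m'"
    proof
      fix x assume x: "x \<in> ?P"
      then have "\<eta> x \<in> \<eta> ` K m'" using BD(2) \<eta> unfolding filtered_auto_def by blast
      then obtain y where y: "y \<in> K m'" "\<eta> x = \<eta> y" by blast
      then have "x = y" using filtered_auto_inj[OF \<eta> _ K_carrier[OF y(1)]] x by simp
      then show "x \<in> K m'" using y(1) by simp
    qed
    moreover have "?P \<noteq> {\<one>}"
    proof
      assume P: "?P = {\<one>}"
      obtain x where x: "x \<in> A" "\<eta> x \<in> B" "\<eta> x \<noteq> \<one>" using BD(3) B(2) by blast
      then have "x \<in> {\<one>}" unfolding P[symmetric] by blast
      then show False using x(3) by simp
    qed
    moreover have "normalized_by G (K m') ?P"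
      unfolding normalized_by_def
    proof (intro ballI)
      fix k x assume k: "k \<in> K m'" and x: "x \<in> ?P"
      have "k \<in> K m" using k K_antimono[OF m'] by blast
      then have 1: "k \<otimes> x \<otimes> inv k \<in> A"
        using local_subgroupD(4)[OF A] x unfolding normalized_by_def by blast
      have "\<eta> k \<in> K m'" using k \<eta> unfolding filtered_auto_def by blast
      then have "\<eta> k \<otimes> \<eta> x \<otimes> inv (\<eta> k) \<in> B"
        using BD(4) x unfolding normalized_by_def by blast
      moreover have "\<eta> (k \<otimes> x \<otimes> inv k) = \<eta> k \<otimes> \<eta> x \<otimes> inv (\<eta> k)"
        using K_carrier[OF k] x by simp
      ultimately show "k \<otimes> x \<otimes> inv k \<in> ?P" using 1 by simp
    qed
    ultimately show ?thesis unfolding local_subgroup_def by blast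
  qed
  \<comment> \<open>If only \<open>b\<close> moves \<open>R\<close> off itself, then \<open>R\<close> meets \<open>\<eta> A\<close>; as the preimage of the intersection
      overlaps with its image, \<open>R\<close> meets \<open>A\<close> too.\<close>
  have meets: "local_subgroup m' (A \<inter> R)"
    using moved
  proof
    assume "elementwise_commute G (conj_set G a R) R"
    then show ?thesis by (rule local_subgroup_meets[OF A a m' R])
  next
    assume "elementwise_commute G (conj_set G b R) R"
    then have "local_subgroup m' (\<eta> ` A \<inter> R)"
      using local_subgroup_meets[OF local_subgroup_image[OF A \<eta>] _ m' R] a by (auto simp: b_def)
    then have "local_subgroup m' {x \<in> A. \<eta> x \<in> \<eta> ` A \<inter> R}" (is "local_subgroup m' ?P")
      by (rule preimage) blast
    then have "local_subgroup m' (?P \<inter> \<eta> ` ?P)" by (rule overlap) blast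
    then obtain c where "c \<in> ?P \<inter> \<eta> ` ?P" "c \<noteq> \<one>" using local_subgroupD(3) by blast
    moreover from this(1) have "c \<in> A" "c \<in> R" by auto
    ultimately have "\<exists>c \<in> A \<inter> R. c \<noteq> \<one>" by blast
    then show ?thesis using local_subgroup_Int[OF A m' R] by blast
  qed
  define D where "D = {x \<in> A. \<eta> x \<in> (A \<inter> R) \<inter> \<eta> ` (A \<inter> R)}"
  have "local_subgroup m' D"
    unfolding D_def by (rule preimage[OF overlap[OF meets]]) auto
  moreover have D: "D \<subseteq> A" "D \<subseteq> R" "\<eta> ` D \<subseteq> R"
  proof -
    show "D \<subseteq> A" "\<eta> ` D \<subseteq> R" unfolding D_def by auto
    show "D \<subseteq> R"
    proof
      fix x assume "x \<in> D"
      then obtain y where y: "y \<in> A" "y \<in> R" "\<eta> x = \<eta> y" "x \<in> A" unfolding D_def by blast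
      then have "x = y" using filtered_auto_inj[OF \<eta>] by auto
      then show "x \<in> R" using y by simp
    qed
  qed
  ultimately have D': "local_subgroup m' (conj_set G a D)" using local_subgroup_conj C by blast
  have "conj_set G a D \<subseteq> A" using D(1) a unfolding conj_set_def by auto
  moreover have "elementwise_commute G (conj_set G a D) (\<eta> ` conj_set G a D)"
  proof (rule elementwise_commute_mono[OF disj])
    show "conj_set G a D \<subseteq> conj_set G a R" using D(2) unfolding conj_set_def by blast
    have "\<eta> (a \<otimes> x \<otimes> inv a) = b \<otimes> \<eta> x \<otimes> inv b" if "x \<in> D" for x
      using that C(1) D(1) unfolding b_def by (simp add: subset_iff)
    then show "\<eta> ` conj_set G a D \<subseteq> conj_set G b R" using D(3) unfolding conj_set_def by force
  qed
  ultimately show False using max[OF m' D'] by blast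
qed

text \<open>
  Since \<open>\<xi>\<close> is an automorphism, the condition makes the first \<open>l\<close> translates of \<open>A\<close> commute pairwise:
  \<open>A\<close> plays the role of a vertex with an orbit of length at least \<open>l\<close>.
\<close>

definition wanders :: "('a \<Rightarrow> 'a) \<Rightarrow> nat \<Rightarrow> 'a set \<Rightarrow> bool" where
  "wanders \<xi> l A \<longleftrightarrow> (\<forall>i. 0 < i \<and> i < l \<longrightarrow> elementwise_commute G A ((\<xi> ^^ i) ` A))"

text \<open>
  Consider the longest wandering of a local subgroup \<open>A\<close>, over all elements of the coset. The automorphism
  returns to \<open>A\<close> as the identity, because otherwise a piece of \<open>A\<close> would wander longer. Multiplying
  the element of the coset by \<open>u \<in> A\<close> does not change the wandering but makes the return
  map a conjugation by \<open>u\<close>, which is not the identity on \<open>A\<close> for suitable \<open>u\<close>.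
\<close>

lemma no_coset_of_bounded_order:
  assumes \<psi>: "filtered_auto \<psi>" and x: "x \<in> carrier G" and M: "0 < M"
    and per: "\<And>h g. h \<in> K m\<^sub>0 \<Longrightarrow> g \<in> carrier G \<Longrightarrow> (inner_twist G \<psi> (h \<otimes> x) ^^ M) g = g"
  shows False
proof -
  let ?\<xi> = "\<lambda>h. inner_twist G \<psi> (h \<otimes> x)"
  have \<xi>: "filtered_auto (?\<xi> h)" if "h \<in> K m\<^sub>0" for h
    using filtered_auto_twist[OF \<psi>] K_carrier[OF that] x by simp
  define P where "P l \<longleftrightarrow> (\<exists>h \<in> K m\<^sub>0. \<exists>m \<ge> m\<^sub>0. \<exists>A. local_subgroup m A \<and> wanders (?\<xi> h) l A)" for l
  \<comment> \<open>After \<open>M\<close> steps \<open>A\<close> is back at itself, and \<open>A\<close> does not commute with \<open>A\<close>.\<close>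
  have bound: "l \<le> M" if "P l" for l
  proof (rule ccontr)
    assume "\<not> l \<le> M"
    from that obtain h m A where h: "h \<in> K m\<^sub>0" "local_subgroup m A" "wanders (?\<xi> h) l A"
      unfolding P_def by blast
    have "A \<subseteq> carrier G" using local_subgroupD(1)[OF h(2)] subgroup.subset by blast
    then have "(?\<xi> h ^^ M) ` A = A" using per[OF h(1)] by (force simp: subset_iff)
    moreover have "elementwise_commute G A ((?\<xi> h ^^ M) ` A)"
      using h(3) M \<open>\<not> l \<le> M\<close> unfolding wanders_def by simp
    ultimately show False using local_subgroup_nonabelian[OF h(2)] by simp
  qed
  obtain g where g: "g \<in> carrier G" "g \<noteq> \<one>" using nontrivial one_closed by blast
  obtain m R where "m \<ge> m\<^sub>0" "local_subgroup m R" using separation_one[OF g, where n = m\<^sub>0] by metis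
  moreover have "wanders \<xi> 1 R" for \<xi> by (simp add: wanders_def)
  ultimately have "P 1" unfolding P_def using subgroup.one_closed[OF K_subgroup] by blast
  then obtain l where l: "P l" and max: "\<And>l'. P l' \<Longrightarrow> l' \<le> l" and "1 \<le> l"
    using GreatestI_nat[of P 1 M] Greatest_le_nat[of P _ M] bound by metis
  then obtain k where k: "l = Suc k" by (cases l) auto
  obtain h m A where h: "h \<in> K m\<^sub>0" and m: "m\<^sub>0 \<le> m" and A: "local_subgroup m A"
    and w: "wanders (?\<xi> h) l A" using l unfolding P_def by blast
  interpret A: subgroup A G by (rule local_subgroupD(1)[OF A])
  have fixed: "(?\<xi> h' ^^ l) a = a" if h': "h' \<in> K m\<^sub>0" "wanders (?\<xi> h') l A" "a \<in> A" for h' a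
  proof (rule auto_trivial_on_local_subgroup[OF filtered_auto_funpow[OF \<xi>[OF h'(1)]] A _ h'(3)])
    fix m' A' assume A': "m \<le> m'" "local_subgroup m' A'" "A' \<subseteq> A"
    show "\<not> elementwise_commute G A' ((?\<xi> h' ^^ l) ` A')"
    proof
      assume e: "elementwise_commute G A' ((?\<xi> h' ^^ l) ` A')"
      have "wanders (?\<xi> h') (Suc l) A'"
        unfolding wanders_def
      proof (intro allI impI)
        fix i assume i: "0 < i \<and> i < Suc l"
        show "elementwise_commute G A' ((?\<xi> h' ^^ i) ` A')"
        proof (cases "i = l")
          case False
          then have "elementwise_commute G A ((?\<xi> h' ^^ i) ` A)"
            using i h'(2) unfolding wanders_def by simp
          then show ?thesis by (rule elementwise_commute_mono) (use A'(3) in auto)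
        qed (use e in simp)
      qed
      then have "P (Suc l)" using h'(1) A'(1,2) m unfolding P_def by (meson order.trans)
      then show False using max by fastforce
    qed
  qed
  obtain u v where uv: "u \<in> A" "v \<in> A" "u \<otimes> v \<noteq> v \<otimes> u"
    using local_subgroup_nonabelian[OF A] unfolding elementwise_commute_def by blast
  have C: "u \<in> carrier G" "v \<in> carrier G" "h \<in> carrier G" using uv K_carrier[OF h] by auto
  have uh: "u \<otimes> h \<in> K m\<^sub>0"
    using h uv(1) local_subgroupD(2)[OF A] K_antimono[OF m] subgroup.m_closed[OF K_subgroup]
    by blast
  have pow_closed: "(?\<xi> h ^^ i) a \<in> carrier G" if "a \<in> carrier G" for a i
    using filtered_auto_funpow[OF \<xi>[OF h], of i] that
    unfolding filtered_auto_def by (auto simp: hom_def)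
  have step: "?\<xi> (u \<otimes> h) g = u \<otimes> ?\<xi> h g \<otimes> inv u" if "g \<in> carrier G" for g
  proof -
    have "\<psi> g \<in> carrier G" using \<psi> that unfolding filtered_auto_def by (auto simp: hom_def)
    then show ?thesis unfolding inner_twist_def using C x by (simp add: group_simps)
  qed
  \<comment> \<open>Before the return, the translates of \<open>A\<close> commute with \<open>u \<in> A\<close>, so the extra conjugation by \<open>u\<close>
      has no effect on them.\<close>
  have same: "(?\<xi> (u \<otimes> h) ^^ i) a = (?\<xi> h ^^ i) a" if "i < l" "a \<in> A" for i a
    using that(1)
  proof (induction i)
    case (Suc i)
    have "elementwise_commute G A ((?\<xi> h ^^ Suc i) ` A)"
      using w Suc.prems unfolding wanders_def by blast
    then have "u \<otimes> (?\<xi> h ^^ Suc i) a = (?\<xi> h ^^ Suc i) a \<otimes> u"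
      using uv(1) that(2) unfolding elementwise_commute_def by blast
    moreover have "(?\<xi> (u \<otimes> h) ^^ Suc i) a = u \<otimes> (?\<xi> h ^^ Suc i) a \<otimes> inv u"
      using Suc step[OF pow_closed] that(2) by simp
    ultimately show ?case
      using cancel_inv_right[OF C(1) pow_closed[of a "Suc i"]] that(2) by simp
  qed simp
  have "wanders (?\<xi> (u \<otimes> h)) l A"
    unfolding wanders_def
  proof (intro allI impI)
    fix i assume i: "0 < i \<and> i < l"
    have "(?\<xi> (u \<otimes> h) ^^ i) ` A = (?\<xi> h ^^ i) ` A" using same i by (intro image_cong) auto
    then show "elementwise_commute G A ((?\<xi> (u \<otimes> h) ^^ i) ` A)"
      using w i unfolding wanders_def by simp
  qed
  then have "(?\<xi> (u \<otimes> h) ^^ l) v = v" using fixed uh uv(2) by blast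
  moreover have "(?\<xi> (u \<otimes> h) ^^ l) v = u \<otimes> (?\<xi> h ^^ l) v \<otimes> inv u"
    using same[of k v] step[OF pow_closed] uv(2) k by simp
  ultimately have "u \<otimes> v \<otimes> inv u = v" using fixed[OF h w uv(2)] by simp
  then have "u \<otimes> v \<otimes> inv u \<otimes> u = v \<otimes> u" by simp
  then show False using uv(3) C by (simp add: cancel_inv_right)
qed

end

section \<open>Finitely many twisted classes\<close>

definition twisted_conjugate :: "('a, 'b) monoid_scheme \<Rightarrow> ('a \<Rightarrow> 'a) \<Rightarrow> 'a \<Rightarrow> 'a \<Rightarrow> 'a" where
  "twisted_conjugate G \<psi> x g = g \<otimes>\<^bsub>G\<^esub> x \<otimes>\<^bsub>G\<^esub> \<psi> (inv\<^bsub>G\<^esub> g)"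

locale filtered_group_auto = filtered_group G K for G (structure) and K +
  fixes \<psi> :: "'a \<Rightarrow> 'a"
  assumes \<psi>: "filtered_auto \<psi>"
begin

sublocale \<psi>: group_hom G G \<psi>
  using \<psi> by (rule filtered_auto_hom)

lemma twisted_closed: "g \<in> carrier G \<Longrightarrow> x \<in> carrier G \<Longrightarrow> twisted_conjugate G \<psi> x g \<in> carrier G"
  by (simp add: twisted_conjugate_def)

lemma twist_funpow_closed:
  assumes "x \<in> carrier G" "u \<in> carrier G"
  shows "(inner_twist G \<psi> x ^^ i) u \<in> carrier G"
  by (induction i) (use assms in \<open>auto simp: inner_twist_def\<close>)

lemma twist_twisted:
  assumes "g \<in> carrier G" "x \<in> carrier G" "u \<in> carrier G"
  shows "(inner_twist G \<psi> (twisted_conjugate G \<psi> x g) ^^ i) (g \<otimes> u \<otimes> inv g) =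
    g \<otimes> (inner_twist G \<psi> x ^^ i) u \<otimes> inv g"
proof (induction i)
  case (Suc i)
  have "(inner_twist G \<psi> x ^^ i) u \<in> carrier G" using assms by (simp add: twist_funpow_closed)
  then show ?case
    using Suc assms by (simp add: inner_twist_def twisted_conjugate_def group_simps)
qed simp

lemma twist_twisted_periodic:
  assumes "g \<in> carrier G" "x \<in> carrier G" "u \<in> carrier G"
    and "\<And>v. v \<in> carrier G \<Longrightarrow> (inner_twist G \<psi> x ^^ M) v = v"
  shows "(inner_twist G \<psi> (twisted_conjugate G \<psi> x g) ^^ M) u = u"
proof -
  have "g \<otimes> (inv g \<otimes> u \<otimes> g) \<otimes> inv g = u" using assms by (simp add: group_simps)
  then show ?thesis
    using twist_twisted[of g x "inv g \<otimes> u \<otimes> g" M] assms by simp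
qed

lemma twist_cong_mod:
  assumes k: "k \<in> K m" and y: "y \<in> carrier G" and u: "u \<in> carrier G"
  shows "K m #> (inner_twist G \<psi> (k \<otimes> y) ^^ i) u = K m #> (inner_twist G \<psi> y ^^ i) u"
proof (induction i)
  case (Suc i)
  define p where "p = (inner_twist G \<psi> (k \<otimes> y) ^^ i) u"
  define q where "q = (inner_twist G \<psi> y ^^ i) u"
  have C: "k \<in> carrier G" "p \<in> carrier G" "q \<in> carrier G"
    using K_carrier[OF k] y u by (auto simp: p_def q_def twist_funpow_closed)
  define e where "e = p \<otimes> inv q"
  have e: "e \<in> K m" using Suc C K_subgroup by (simp add: e_def p_def q_def rcos_eq_iff)
  have eC: "e \<in> carrier G" using K_carrier[OF e] .
  have pe: "p = e \<otimes> q" unfolding e_def using C by (simp add: cancel_inv_right)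
  define t where "t = y \<otimes> \<psi> q \<otimes> inv y"
  have tC: "t \<in> carrier G" unfolding t_def using C y by simp
  have "\<psi> e \<in> K m" using e \<psi> unfolding filtered_auto_def by blast
  then have "y \<otimes> \<psi> e \<otimes> inv y \<in> K m" using K_conj y by blast
  moreover have "t \<otimes> inv k \<otimes> inv t \<in> K m"
    using K_conj[OF tC] subgroup.m_inv_closed[OF K_subgroup k] by blast
  ultimately have d: "k \<otimes> (y \<otimes> \<psi> e \<otimes> inv y) \<otimes> (t \<otimes> inv k \<otimes> inv t) \<in> K m" (is "?d \<in> _")
    using k subgroup.m_closed[OF K_subgroup] by blast
  have "inner_twist G \<psi> (k \<otimes> y) p = ?d \<otimes> t"
    unfolding pe inner_twist_def t_def using C eC y by (simp add: group_simps)
  then have "K m #> inner_twist G \<psi> (k \<otimes> y) p = K m #> t"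
    using rcos_eq_mult[OF K_subgroup d tC] by simp
  then show ?case unfolding p_def q_def t_def by (simp add: inner_twist_def)
qed simp

lemma twisted_cong_mod:
  assumes "g \<in> carrier G" "h \<in> carrier G" "x \<in> carrier G" "K m #> g = K m #> h"
  shows "K m #> twisted_conjugate G \<psi> x g = K m #> twisted_conjugate G \<psi> x h"
proof -
  define e where "e = g \<otimes> inv h"
  have e: "e \<in> K m" using assms K_subgroup by (simp add: e_def rcos_eq_iff)
  have eC: "e \<in> carrier G" using K_carrier[OF e] .
  have ge: "g = e \<otimes> h" unfolding e_def using assms by (simp add: cancel_inv_right)
  define p where "p = twisted_conjugate G \<psi> x h"
  have pC: "p \<in> carrier G" unfolding p_def using assms by (simp add: twisted_closed)
  have "\<psi> (inv e) \<in> K m"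
    using subgroup.m_inv_closed[OF K_subgroup e] \<psi> unfolding filtered_auto_def by blast
  then have d: "e \<otimes> (p \<otimes> \<psi> (inv e) \<otimes> inv p) \<in> K m" (is "?d \<in> _")
    using K_conj[OF pC] subgroup.m_closed[OF K_subgroup e] by blast
  have "twisted_conjugate G \<psi> x g = ?d \<otimes> p"
    unfolding ge p_def twisted_conjugate_def using eC assms by (simp add: group_simps)
  then show ?thesis using rcos_eq_mult[OF K_subgroup d pC] by (simp add: p_def)
qed

text \<open>
  The equation \<open>x \<otimes> \<psi> z \<otimes> inv x = z\<close> says that twisted conjugation by \<open>z\<close> leaves \<open>x\<close> in place.
\<close>

lemma twisted_stabilizer:
  assumes C: "g \<in> carrier G" "z \<in> carrier G" "x \<in> carrier G" and z: "inner_twist G \<psi> x z = z"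
  shows "twisted_conjugate G \<psi> x (g \<otimes> z [^] (j::nat)) = twisted_conjugate G \<psi> x g"
proof (induction j)
  case (Suc j)
  have zj: "z [^] j \<in> carrier G" using C by simp
  have "x \<otimes> \<psi> z \<otimes> inv x \<otimes> x = z \<otimes> x" using z by (simp add: inner_twist_def)
  then have xz: "x \<otimes> \<psi> z = z \<otimes> x" using C by (simp add: cancel_inv_right)
  have "z \<otimes> (x \<otimes> inv (\<psi> z)) = (x \<otimes> \<psi> z) \<otimes> inv (\<psi> z)" using C xz by (simp add: m_assoc)
  then have "z \<otimes> (x \<otimes> inv (\<psi> z)) = x" using C by (simp add: cancel_inv_right)
  then have "z \<otimes> (x \<otimes> (inv (\<psi> z) \<otimes> w)) = x \<otimes> w" if "w \<in> carrier G" for w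
    using C that by (metis m_assoc m_closed inv_closed \<psi>.hom_closed)
  then show ?case using Suc C zj by (simp add: twisted_conjugate_def group_simps)
qed (use C in simp)

text \<open>
  Orbit counting in the finite group \<open>G / K m'\<close>, without naming the action. Let \<open>S\<close> be the image of \<open>K m\<close>
  there and \<open>N\<close> the index of \<open>K m\<close>, so \<open>G / K m'\<close> has at most \<open>|S| N\<close> elements. For each coset
  \<open>Q \<in> S\<close> choose an element \<open>\<gamma> Q\<close> that takes \<open>x\<close> to \<open>Q x\<close>. If \<open>z\<close>, which stabilizes \<open>x\<close>, had
  no power \<open>z [^] j\<close> in \<open>K m'\<close> with \<open>0 < j \<le> N\<close>, then the products \<open>\<gamma> Q \<otimes> z [^] j\<close> with
  \<open>j \<le> N\<close> would represent \<open>|S| (N + 1)\<close> different elements. The bound \<open>N\<close> does not depend on \<open>m'\<close>.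
\<close>

lemma fixed_power_in_filtration:
  assumes fin: "\<And>i. finite (rcosets (K i))" and x: "x \<in> carrier G" and z: "z \<in> carrier G"
    and fixed: "inner_twist G \<psi> x z = z" and m: "m \<le> m'"
    and dense: "\<And>a. a \<in> K m \<Longrightarrow>
      \<exists>g \<in> carrier G. K m' #> twisted_conjugate G \<psi> x g = K m' #> (a \<otimes> x)"
  shows "\<exists>j. 0 < j \<and> j \<le> card (rcosets (K m)) \<and> z [^] j \<in> K m'"
proof (rule ccontr)
  assume no: "\<not> ?thesis"
  let ?N = "card (rcosets (K m))"
  define S where "S = (\<lambda>g. K m' #> g) ` K m"
  have all: "(\<lambda>g. K m' #> g) ` carrier G = rcosets (K m')" "(\<lambda>g. K m #> g) ` carrier G = rcosets (K m)"
    by (auto simp: RCOSETS_def)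
  have S: "S \<subseteq> rcosets (K m')" unfolding S_def using K_carrier all by blast
  then have finS: "finite S" using fin finite_subset by blast
  have "S \<noteq> {}" unfolding S_def using subgroup.one_closed[OF K_subgroup] by blast
  then have posS: "0 < card S" using finS by (simp add: card_gt_0_iff)
  define rep where "rep T = (SOME t. t \<in> carrier G \<and> K m #> t = T)" for T
  have rep: "rep (K m #> g) \<in> carrier G" "K m #> rep (K m #> g) = K m #> g"
    if "g \<in> carrier G" for g
    using someI_ex[of "\<lambda>t. t \<in> carrier G \<and> K m #> t = K m #> g"] that unfolding rep_def by blast+
  \<comment> \<open>An element of \<open>G / K m'\<close> is a product of an element of \<open>S\<close> and a representative of its coset
      modulo \<open>K m\<close>.\<close>
  have "rcosets (K m') \<subseteq> (\<lambda>(Q, T). Q #> rep T) ` (S \<times> rcosets (K m))"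
  proof
    fix Q assume "Q \<in> rcosets (K m')"
    then obtain g where g: "g \<in> carrier G" "Q = K m' #> g" using all by blast
    let ?s = "rep (K m #> g)"
    have s: "?s \<in> carrier G" "g \<otimes> inv ?s \<in> K m"
      using rep[OF g(1)] g(1) K_subgroup rcos_eq_iff by metis+
    have "Q = (K m' #> (g \<otimes> inv ?s)) #> ?s"
      using g s subgroup.subset[OF K_subgroup]
      by (simp add: coset_mult_assoc cancel_inv_right)
    moreover have "K m #> g \<in> rcosets (K m)" using all g(1) by blast
    ultimately show "Q \<in> (\<lambda>(Q, T). Q #> rep T) ` (S \<times> rcosets (K m))"
      using s(2) unfolding S_def by force
  qed
  then have "card (rcosets (K m')) \<le> card (S \<times> rcosets (K m))"
    using finS fin surj_card_le[of "S \<times> rcosets (K m)" "rcosets (K m')"] by blast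
  then have le: "card (rcosets (K m')) \<le> card S * ?N" by (simp add: card_cartesian_product)
  have "\<exists>g. g \<in> carrier G \<and> K m' #> twisted_conjugate G \<psi> x g = Q #> x" if Q: "Q \<in> S" for Q
  proof -
    obtain a where a: "a \<in> K m" "Q = K m' #> a" using Q unfolding S_def by blast
    then have "Q #> x = K m' #> (a \<otimes> x)"
      using x K_carrier subgroup.subset[OF K_subgroup] by (simp add: coset_mult_assoc)
    then show ?thesis using dense[OF a(1)] by metis
  qed
  then obtain \<gamma> where \<gamma>: "\<And>Q. Q \<in> S \<Longrightarrow> \<gamma> Q \<in> carrier G"
    "\<And>Q. Q \<in> S \<Longrightarrow> K m' #> twisted_conjugate G \<psi> x (\<gamma> Q) = Q #> x" by metis
  let ?f = "\<lambda>(Q, j). K m' #> (\<gamma> Q \<otimes> z [^] (j::nat))"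
  have zC: "z [^] (j::nat) \<in> carrier G" for j using z by simp
  \<comment> \<open>Twisted conjugation of \<open>x\<close> by the product does not see the power of \<open>z\<close>, so it recovers \<open>Q\<close>; then
      two equal products differ by a power of \<open>z\<close> in \<open>K m'\<close>.\<close>
  have "inj_on ?f (S \<times> {..?N})"
  proof -
    have "Q = Q' \<and> j = j'"
      if Q: "Q \<in> S" "Q' \<in> S" and j: "j \<le> j'" "j' \<le> ?N"
        and eq: "K m' #> (\<gamma> Q \<otimes> z [^] j) = K m' #> (\<gamma> Q' \<otimes> z [^] j')" for Q Q' j j'
    proof
      have "Q #> x = Q' #> x"
        using twisted_cong_mod[OF _ _ x eq] \<gamma> Q zC twisted_stabilizer[OF _ z x fixed] by simp
      then have "Q #> x #> inv x = Q' #> x #> inv x" by simp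
      moreover have "Y #> x #> inv x = Y" if "Y \<in> S" for Y
      proof -
        have "Y \<subseteq> carrier G" using that S rcosets_part_G[OF K_subgroup] by blast
        then show ?thesis using x by (simp add: coset_mult_assoc)
      qed
      ultimately show QQ: "Q = Q'" using Q by simp
      have "\<gamma> Q \<otimes> z [^] j' \<otimes> inv (\<gamma> Q \<otimes> z [^] j) \<in> K m'"
        using eq[symmetric] QQ Q \<gamma>(1) zC K_subgroup by (simp add: rcos_eq_iff)
      then have "inv (\<gamma> Q) \<otimes> (\<gamma> Q \<otimes> z [^] j' \<otimes> inv (\<gamma> Q \<otimes> z [^] j)) \<otimes> inv (inv (\<gamma> Q)) \<in> K m'"
        using K_conj Q \<gamma>(1) by blast
      moreover have "inv (\<gamma> Q) \<otimes> (\<gamma> Q \<otimes> z [^] j' \<otimes> inv (\<gamma> Q \<otimes> z [^] j)) \<otimes> inv (inv (\<gamma> Q)) =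
        z [^] j' \<otimes> inv (z [^] j)"
        using Q \<gamma>(1) zC by (simp add: group_simps)
      moreover have "z [^] j' = z [^] (j' - j) \<otimes> z [^] j" using j z by (simp add: nat_pow_mult)
      ultimately have "z [^] (j' - j) \<in> K m'" using zC by (simp add: cancel_inv_right)
      then have "\<not> 0 < j' - j" using no j by (meson diff_le_self le_trans)
      then show "j = j'" using j by simp
    qed
    then show ?thesis
      unfolding inj_on_def by clarsimp (metis nat_le_linear)
  qed
  moreover have "?f ` (S \<times> {..?N}) \<subseteq> rcosets (K m')"
    using all \<gamma>(1) zC by force
  ultimately have "card (S \<times> {..?N}) \<le> card (rcosets (K m'))"
    using fin card_inj_on_le by blast
  then have "card S * Suc ?N \<le> card S * ?N" using le by (simp add: card_cartesian_product)
  then show False using posS by simp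
qed

end

lemma (in group) twisted_conj_iff:
  "(x, y) \<in> twisted_conj G \<psi> \<longleftrightarrow>
     x \<in> carrier G \<and> y \<in> carrier G \<and> (\<exists>g \<in> carrier G. y = twisted_conjugate G \<psi> x g)"
  by (auto simp: twisted_conj_def twisted_conjugate_def)

text \<open>
  A Baire category argument in finite form: among all cosets of all \<open>K m\<close>, choose one that meets the
  fewest classes. Every smaller coset inside it meets the same classes, so every class that meets it is
  dense in it; the class of the representative \<open>x\<close> is one of them.
\<close>

lemma (in filtered_group) dense_twisted_class:
  assumes \<psi>: "\<psi> \<in> auto G" and fin: "finite (carrier G // twisted_conj G \<psi>)"
  obtains x m where "x \<in> carrier G"
    "\<And>a m'. a \<in> K m \<Longrightarrow> m \<le> m' \<Longrightarrow>
       \<exists>g \<in> carrier G. \<exists>k \<in> K m'. twisted_conjugate G \<psi> x g = k \<otimes> (a \<otimes> x)"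
proof -
  define D where "D = (\<lambda>(m, x). {C \<in> carrier G // twisted_conj G \<psi>. C \<inter> (K m #> x) \<noteq> {}})"
  obtain p where p: "snd p \<in> carrier G"
    and min: "\<And>q. snd q \<in> carrier G \<Longrightarrow> card (D p) \<le> card (D q)"
    using ex_has_least_nat[of "\<lambda>p. snd p \<in> carrier G" "(0, \<one>)" "\<lambda>p. card (D p)"] by force
  obtain m x where mx: "p = (m, x)" by (cases p)
  have x: "x \<in> carrier G" using p mx by simp
  have finD: "finite (D q)" for q unfolding D_def using fin by (simp add: case_prod_beta)
  show ?thesis
  proof (rule that[OF x])
    fix a m' assume a: "a \<in> K m" and m': "m \<le> m'"
    have aC: "a \<in> carrier G" using K_carrier[OF a] .
    have "K m' #> (a \<otimes> x) \<subseteq> K m #> (a \<otimes> x)"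
      using K_antimono[OF m'] by (auto simp: r_coset_def)
    also have "K m #> (a \<otimes> x) = K m #> x" by (rule rcos_eq_mult[OF K_subgroup a x])
    finally have "D (m', a \<otimes> x) \<subseteq> D p" unfolding D_def mx by auto
    moreover have "card (D p) \<le> card (D (m', a \<otimes> x))" by (rule min) (simp add: aC x)
    ultimately have "D (m', a \<otimes> x) = D p" by (intro card_seteq finD)
    moreover have "twisted_conj G \<psi> `` {x} \<in> D p"
    proof -
      have "x \<in> twisted_conj G \<psi> `` {x}"
        using equiv_class_self[OF equiv_twisted_conj[OF \<psi>] x] .
      moreover have "x \<in> K m #> x" using rcos_self[OF x K_subgroup] .
      ultimately show ?thesis unfolding D_def mx using x by (auto intro: quotientI)
    qed
    ultimately have "twisted_conj G \<psi> `` {x} \<in> D (m', a \<otimes> x)" by simp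
    then obtain y where "(x, y) \<in> twisted_conj G \<psi>" "y \<in> K m' #> (a \<otimes> x)"
      unfolding D_def by auto
    then obtain g k where "g \<in> carrier G" "y = twisted_conjugate G \<psi> x g" "k \<in> K m'" "y = k \<otimes> (a \<otimes> x)"
      unfolding twisted_conj_iff r_coset_def by blast
    then show "\<exists>g \<in> carrier G. \<exists>k \<in> K m'. twisted_conjugate G \<psi> x g = k \<otimes> (a \<otimes> x)" by metis
  qed
qed

text \<open>
  Density of the class of \<open>x\<close> in \<open>K m x\<close> yields that all automorphisms from this coset have orders dividing
  one number \<open>M\<close>: the bound for \<open>x\<close> comes from \<open>fixed_power_in_filtration\<close>, and it transfers to \<open>y\<close> because
  modulo every \<open>K m'\<close> the automorphism of \<open>y\<close> agrees with one that is conjugate to that of \<open>x\<close>.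
\<close>

theorem (in separated_filtered_group) infinitely_many_twisted_classes:
  assumes \<psi>: "\<psi> \<in> auto G" "\<And>m. \<psi> ` K m = K m"
    and fin: "\<And>m. finite (rcosets (K m))"
    and int: "\<And>g. (\<And>m. g \<in> K m) \<Longrightarrow> g = \<one>"
    and n: "0 < n" and c: "c \<in> carrier G"
    and inner: "\<And>g. g \<in> carrier G \<Longrightarrow> (\<psi> ^^ n) g = c \<otimes> g \<otimes> inv c"
  shows "infinite (carrier G // twisted_conj G \<psi>)"
proof
  assume "finite (carrier G // twisted_conj G \<psi>)"
  from dense_twisted_class[OF \<psi>(1) this]
  obtain x m where x: "x \<in> carrier G"
    and dense: "\<And>a m'. a \<in> K m \<Longrightarrow> m \<le> m' \<Longrightarrow>
       \<exists>g \<in> carrier G. \<exists>k \<in> K m'. twisted_conjugate G \<psi> x g = k \<otimes> (a \<otimes> x)" by blast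
  have fa: "filtered_auto \<psi>" using \<psi> by (auto simp: filtered_auto_def auto_def Bij_def)
  interpret filtered_group_auto G K \<psi> by unfold_locales (rule fa)
  interpret \<xi>: group_hom G G "inner_twist G \<psi> x" by (rule filtered_auto_hom[OF filtered_auto_twist[OF fa x]])
  have "\<exists>z \<in> carrier G. \<forall>g \<in> carrier G. (inner_twist G \<psi> x ^^ i) g = z \<otimes> (\<psi> ^^ i) g \<otimes> inv z" for i
  proof (induction i)
    case 0
    then show ?case by (auto intro!: bexI[of _ \<one>])
  next
    case (Suc i)
    then obtain z where z: "z \<in> carrier G"
      "\<And>g. g \<in> carrier G \<Longrightarrow> (inner_twist G \<psi> x ^^ i) g = z \<otimes> (\<psi> ^^ i) g \<otimes> inv z" by blast
    have "(\<psi> ^^ i) g \<in> carrier G" if "g \<in> carrier G" for g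
      using that by (induction i) auto
    then show ?case
      using z x by (intro bexI[of _ "x \<otimes> \<psi> z"]) (auto simp: inner_twist_def group_simps)
  qed
  then obtain z' where z': "z' \<in> carrier G"
    "\<And>g. g \<in> carrier G \<Longrightarrow> (inner_twist G \<psi> x ^^ n) g = z' \<otimes> (\<psi> ^^ n) g \<otimes> inv z'" by blast
  define z where "z = z' \<otimes> c"
  have z: "z \<in> carrier G" unfolding z_def using z' c by simp
  have pow: "(inner_twist G \<psi> x ^^ n) g = z \<otimes> g \<otimes> inv z" if "g \<in> carrier G" for g
    unfolding z_def using z' c inner[OF that] that by (simp add: group_simps)
  \<comment> \<open>The automorphism \<open>\<xi>\<close> of \<open>x\<close> commutes with \<open>\<xi> ^^ n\<close>, so \<open>z\<close> and \<open>\<xi> z\<close> induce the same inner automorphism,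
      and the center is trivial.\<close>
  have fixed: "inner_twist G \<psi> x z = z"
  proof -
    define w where "w = inner_twist G \<psi> x z"
    have w: "w \<in> carrier G" unfolding w_def using z by simp
    have "w \<otimes> h \<otimes> inv w = z \<otimes> h \<otimes> inv z" if h: "h \<in> carrier G" for h
    proof -
      have "inner_twist G \<psi> x ` carrier G = carrier G"
        using filtered_auto_twist[OF fa x] unfolding filtered_auto_def bij_betw_def by blast
      then obtain g where g: "g \<in> carrier G" "h = inner_twist G \<psi> x g" using h by blast
      have "w \<otimes> h \<otimes> inv w = inner_twist G \<psi> x (z \<otimes> g \<otimes> inv z)"
        unfolding w_def g(2) using g(1) z by simp
      also have "\<dots> = inner_twist G \<psi> x ((inner_twist G \<psi> x ^^ n) g)" using pow[OF g(1)] by simp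
      also have "\<dots> = (inner_twist G \<psi> x ^^ n) (inner_twist G \<psi> x g)" by (simp add: funpow_swap1)
      also have "\<dots> = z \<otimes> h \<otimes> inv z" unfolding g(2) using pow g(1) by simp
      finally show ?thesis .
    qed
    note eq = this
    have "inv z \<otimes> w = \<one>"
    proof (rule center_trivial)
      fix h assume h: "h \<in> carrier G"
      have "inv z \<otimes> (w \<otimes> h \<otimes> inv w) \<otimes> w = inv z \<otimes> (z \<otimes> h \<otimes> inv z) \<otimes> w" using eq[OF h] by simp
      then show "inv z \<otimes> w \<otimes> h = h \<otimes> (inv z \<otimes> w)" using z w h by (simp add: group_simps)
    qed (use z w in simp)
    then have "z \<otimes> (inv z \<otimes> w) = z" using z by simp
    then show ?thesis using z w by (simp add: cancel_inv w_def)
  qed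
  \<comment> \<open>The exponent \<open>j \<le> N\<close> depends on \<open>m'\<close>; its multiple \<open>fact N\<close> does not.\<close>
  define N where "N = card (rcosets (K m))"
  have zN: "z [^] (fact N :: nat) \<in> K m'" for m'
  proof -
    define l where "l = max m m'"
    have "\<exists>g \<in> carrier G. K l #> twisted_conjugate G \<psi> x g = K l #> (a \<otimes> x)" if "a \<in> K m" for a
      using dense[OF that, of l] rcos_eq_mult[OF K_subgroup] x K_carrier[OF that]
      unfolding l_def by (metis m_closed max.cobounded1)
    then obtain j where j: "0 < j" "j \<le> N" "z [^] j \<in> K l"
      using fixed_power_in_filtration[OF fin x z fixed, of m l] unfolding N_def l_def by auto
    then obtain d where "fact N = j * d" using dvd_fact[of j N] by (auto simp: dvd_def)
    moreover have "(z [^] j) [^] d \<in> K l"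
      using j(3) subgroup.one_closed[OF K_subgroup] subgroup.m_closed[OF K_subgroup]
      by (induction d) auto
    ultimately have "z [^] (fact N :: nat) \<in> K l" using z by (simp add: nat_pow_pow)
    then show ?thesis using K_antimono[of m' l] unfolding l_def by auto
  qed
  define M where "M = n * fact N"
  have perx: "(inner_twist G \<psi> x ^^ M) g = g" if "g \<in> carrier G" for g
  proof -
    have "((inner_twist G \<psi> x ^^ n) ^^ j) g = z [^] j \<otimes> g \<otimes> inv (z [^] j)" for j
    proof (induction j)
      case 0
      then show ?case using that by simp
    next
      case (Suc j)
      have "z [^] j \<in> carrier G" using z by simp
      then have "((inner_twist G \<psi> x ^^ n) ^^ Suc j) g = (z \<otimes> z [^] j) \<otimes> g \<otimes> inv (z \<otimes> z [^] j)"
        using Suc pow that z by (simp add: group_simps)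
      then show ?case using z by (metis nat_pow_Suc2)
    qed
    from this[of "fact N"] show ?thesis
      using int[OF zN] that unfolding M_def by (simp add: funpow_mult mult.commute)
  qed
  show False
  proof (rule no_coset_of_bounded_order[OF fa x])
    show "0 < M" unfolding M_def using n by simp
    fix a u assume a: "a \<in> K m" and u: "u \<in> carrier G"
    define y where "y = a \<otimes> x"
    have y: "y \<in> carrier G" unfolding y_def using K_carrier[OF a] x by simp
    define v where "v = (inner_twist G \<psi> y ^^ M) u"
    have v: "v \<in> carrier G" unfolding v_def using y u by (rule twist_funpow_closed)
    have "u \<otimes> inv v \<in> K m'" for m'
    proof -
      define l where "l = max m m'"
      obtain g k where gk: "g \<in> carrier G" "k \<in> K l" "twisted_conjugate G \<psi> x g = k \<otimes> y"
        using dense[OF a, of l] unfolding y_def l_def by auto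
      have "K l #> u = K l #> v"
        using twist_cong_mod[OF gk(2) y u, of M] twist_twisted_periodic[OF gk(1) x u perx]
        unfolding gk(3) v_def by simp
      then have "u \<otimes> inv v \<in> K l" using rcos_eq_iff[OF K_subgroup] u v by simp
      then show ?thesis using K_antimono[of m' l] unfolding l_def by auto
    qed
    then have "u \<otimes> inv v = \<one>" by (rule int)
    then have "u \<otimes> inv v \<otimes> v = v" using v by simp
    then show "(inner_twist G \<psi> (a \<otimes> x) ^^ M) u = u"
      using u v by (simp add: cancel_inv_right v_def y_def)
  qed
qed

section \<open>Levels and subtrees\<close>

context rooted_tree
begin

lemma relpow_from_root_unique:
  "(r, v) \<in> E ^^ m \<Longrightarrow> (r, v) \<in> E ^^ n \<Longrightarrow> m = n"
proof (induction m arbitrary: v n)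
  case 0
  then show ?case using root_no_parent by (cases n) auto
next
  case (Suc m)
  obtain u where u: "(r, u) \<in> E ^^ m" "(u, v) \<in> E" using Suc.prems(1) by auto
  show ?case
  proof (cases n)
    case 0
    then show ?thesis using Suc.prems(2) u root_no_parent by auto
  next
    case (Suc n')
    then obtain u' where u': "(r, u') \<in> E ^^ n'" "(u', v) \<in> E" using Suc.prems(2) by auto
    then have "u' = u" using unique_parent u(2) by blast
    then show ?thesis using Suc.IH[OF u(1)] u'(1) Suc by simp
  qed
qed

lemma relpow_source_unique:
  "(v, u) \<in> E ^^ i \<Longrightarrow> (w, u) \<in> E ^^ i \<Longrightarrow> v = w"
proof (induction i arbitrary: u)
  case (Suc i)
  then obtain x y where "(v, x) \<in> E ^^ i" "(x, u) \<in> E" "(w, y) \<in> E ^^ i" "(y, u) \<in> E" by auto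
  then show ?case using Suc.IH unique_parent by blast
qed simp

lemma level_iff: "v \<in> level E r n \<longleftrightarrow> (r, v) \<in> E ^^ n"
  by (simp add: level_def)

lemma relpow_in_V: "(u, w) \<in> E ^^ i \<Longrightarrow> u \<in> V \<Longrightarrow> w \<in> V"
  using edges_in by (cases i) auto

lemma level_subset: "level E r n \<subseteq> V"
  using relpow_in_V root_in by (auto simp: level_iff)

lemma in_some_level: "v \<in> V \<Longrightarrow> \<exists>n. v \<in> level E r n"
  using reachable rtrancl_imp_relpow by (fastforce simp: level_iff)

lemma subtree_iff: "w \<in> subtree E v \<longleftrightarrow> (\<exists>i. (v, w) \<in> E ^^ i)"
  by (auto simp: subtree_def rtrancl_is_UN_relpow)

lemma subtree_level:
  assumes "v \<in> level E r n" "w \<in> subtree E v" "w \<in> level E r m"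
  shows "n \<le> m" "(v, w) \<in> E ^^ (m - n)"
proof -
  obtain i where i: "(v, w) \<in> E ^^ i" using assms(2) by (auto simp: subtree_iff)
  then have "(r, w) \<in> E ^^ (n + i)" using assms(1) by (auto simp: level_iff relpow_add)
  then have "m = n + i" using assms(3) relpow_from_root_unique by (auto simp: level_iff)
  then show "n \<le> m" "(v, w) \<in> E ^^ (m - n)" using i by auto
qed

lemma subtree_disjoint:
  assumes "v \<in> level E r n" "w \<in> level E r n" "u \<in> subtree E v" "u \<in> subtree E w"
  shows "v = w"
proof -
  obtain i where "(v, u) \<in> E ^^ i" using assms(3) by (auto simp: subtree_iff)
  then have "(r, u) \<in> E ^^ (n + i)" using assms(1) by (auto simp: level_iff relpow_add)
  then have "u \<in> level E r (n + i)" by (simp add: level_iff)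
  then show ?thesis
    using subtree_level(2)[OF assms(1,3)] subtree_level(2)[OF assms(2,4)] relpow_source_unique
    by blast
qed

lemma self_in_subtree: "v \<in> subtree E v"
  by (simp add: subtree_def)

lemma subtree_subset: "w \<in> subtree E v \<Longrightarrow> subtree E w \<subseteq> subtree E v"
  by (auto simp: subtree_def)

end

lemma (in spherically_symmetric_tree) finite_level: "finite (level E r n)"
proof (induction n)
  case 0
  then show ?case by (simp add: level_def)
next
  case (Suc n)
  have "level E r (Suc n) = (\<Union>v \<in> level E r n. E `` {v})" by (auto simp: level_def)
  then show ?case using Suc spherically_symmetric[of n] by auto
qed

section \<open>Rigid stabilizers\<close>

context weakly_branch_group
begin

sublocale group G
  using group_hom group_hom.axioms(1) by blast

lemma act_closed: "g \<in> carrier G \<Longrightarrow> v \<in> V \<Longrightarrow> \<phi> g v \<in> V"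
  using element_image by blast

lemma act_inj: "g \<in> carrier G \<Longrightarrow> v \<in> V \<Longrightarrow> w \<in> V \<Longrightarrow> \<phi> g v = \<phi> g w \<Longrightarrow> v = w"
  using inj_prop by (auto dest: inj_onD)

lemma act_one: "v \<in> V \<Longrightarrow> \<phi> \<one> v = v"
  using id_eq_one by (metis restrict_apply')

lemma act_mult: "g \<in> carrier G \<Longrightarrow> h \<in> carrier G \<Longrightarrow> v \<in> V \<Longrightarrow> \<phi> (g \<otimes> h) v = \<phi> g (\<phi> h v)"
  by (rule composition_rule)

lemma act_inv: "g \<in> carrier G \<Longrightarrow> v \<in> V \<Longrightarrow> \<phi> g (\<phi> (inv g) v) = v"
  "g \<in> carrier G \<Longrightarrow> v \<in> V \<Longrightarrow> \<phi> (inv g) (\<phi> g v) = v"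
  using act_mult[of g "inv g" v] act_mult[of "inv g" g v] act_one by auto

lemma act_faithful:
  assumes "g \<in> carrier G" "h \<in> carrier G" "\<And>v. v \<in> V \<Longrightarrow> \<phi> g v = \<phi> h v"
  shows "g = h"
proof -
  have "\<phi> g \<in> extensional V" "\<phi> h \<in> extensional V" using bij_prop0 assms by (auto simp: Bij_def)
  then have "\<phi> g = \<phi> h" using assms(3) by (rule extensionalityI)
  then show ?thesis using faithful assms by (auto dest: inj_onD)
qed

lemma act_relpow:
  assumes g: "g \<in> carrier G"
  shows "(u, w) \<in> E ^^ i \<Longrightarrow> u \<in> V \<Longrightarrow> (\<phi> g u, \<phi> g w) \<in> E ^^ i"
proof (induction i arbitrary: w)
  case (Suc i)
  then obtain x where x: "(u, x) \<in> E ^^ i" "(x, w) \<in> E" by auto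
  moreover have "x \<in> V" "w \<in> V" using x(2) edges_in by auto
  ultimately have "(\<phi> g x, \<phi> g w) \<in> E"
    using automorphisms[OF g] unfolding tree_automorphism_def by blast
  then show ?case using Suc.IH[OF x(1) Suc.prems(2)] by auto
qed simp

lemma act_level:
  assumes "g \<in> carrier G" "v \<in> level E r n"
  shows "\<phi> g v \<in> level E r n"
  using act_relpow[OF assms(1), of r v n] assms root_in automorphisms[OF assms(1)]
  by (simp add: level_iff tree_automorphism_def)

lemma act_subtree:
  assumes "g \<in> carrier G" "v \<in> V" "w \<in> subtree E v"
  shows "\<phi> g w \<in> subtree E (\<phi> g v)"
  using assms act_relpow[OF assms(1)] unfolding subtree_iff by blast

definition rigid_stabilizer :: "'v \<Rightarrow> 'a set" where
  "rigid_stabilizer v = {g \<in> carrier G. \<forall>w \<in> V - subtree E v. \<phi> g w = w}"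

lemma pointwise_fixer_subgroup:
  assumes "S \<subseteq> V"
  shows "subgroup {g \<in> carrier G. \<forall>w \<in> S. \<phi> g w = w} G"
proof (rule subgroupI)
  show "{g \<in> carrier G. \<forall>w \<in> S. \<phi> g w = w} \<noteq> {}" using act_one assms by blast
  fix g assume g: "g \<in> {g \<in> carrier G. \<forall>w \<in> S. \<phi> g w = w}"
  then show "inv g \<in> {g \<in> carrier G. \<forall>w \<in> S. \<phi> g w = w}"
    using act_inv(2) assms by (auto simp: subset_iff) metis
next
  fix g h
  assume "g \<in> {g \<in> carrier G. \<forall>w \<in> S. \<phi> g w = w}" "h \<in> {g \<in> carrier G. \<forall>w \<in> S. \<phi> g w = w}"
  then show "g \<otimes> h \<in> {g \<in> carrier G. \<forall>w \<in> S. \<phi> g w = w}"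
    using act_mult assms by (auto simp: subset_iff)
qed auto

lemma rist_subgroup: "subgroup (rigid_stabilizer v) G"
  unfolding rigid_stabilizer_def by (rule pointwise_fixer_subgroup) auto

lemma rist_carrier: "g \<in> rigid_stabilizer v \<Longrightarrow> g \<in> carrier G"
  by (simp add: rigid_stabilizer_def)

lemma rist_mono: "w \<in> subtree E v \<Longrightarrow> rigid_stabilizer w \<subseteq> rigid_stabilizer v"
  using subtree_subset[of w v] by (auto simp: rigid_stabilizer_def)

lemma rist_conj:
  assumes g: "g \<in> carrier G" and v: "v \<in> V" and u: "u \<in> rigid_stabilizer v"
  shows "g \<otimes> u \<otimes> inv g \<in> rigid_stabilizer (\<phi> g v)"
proof -
  have uC: "u \<in> carrier G" using u by (rule rist_carrier)
  have "\<phi> (g \<otimes> u \<otimes> inv g) w = w" if w: "w \<in> V" "w \<notin> subtree E (\<phi> g v)" for w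
  proof -
    define w' where "w' = \<phi> (inv g) w"
    have w': "w' \<in> V" "\<phi> g w' = w" unfolding w'_def using act_closed act_inv g w(1) by auto
    have "w' \<notin> subtree E v" using act_subtree[OF g v] w w'(2) by blast
    then have "\<phi> u w' = w'" using u w'(1) by (simp add: rigid_stabilizer_def)
    then show ?thesis using g uC w(1) w' by (simp add: act_mult act_closed w'_def[symmetric])
  qed
  then show ?thesis using g uC by (simp add: rigid_stabilizer_def)
qed

lemma rist_preserves_subtree:
  assumes g: "g \<in> rigid_stabilizer v" and u: "u \<in> V"
  shows "\<phi> g u \<in> subtree E v \<longleftrightarrow> u \<in> subtree E v"
proof -
  have gC: "g \<in> carrier G" using g by (rule rist_carrier)
  have "\<phi> g (\<phi> g u) = \<phi> g u" if "\<phi> g u \<notin> subtree E v"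
    using g that act_closed[OF gC u] by (simp add: rigid_stabilizer_def)
  then have "\<phi> g u = u" if "\<phi> g u \<notin> subtree E v"
    using that act_inj[OF gC act_closed[OF gC u] u] by blast
  moreover have "\<phi> g u = u" if "u \<notin> subtree E v" using g u that by (simp add: rigid_stabilizer_def)
  ultimately show ?thesis by metis
qed

lemma rist_commute:
  assumes v: "v \<in> level E r n" and w: "w \<in> level E r n" and vw: "v \<noteq> w"
    and g: "g \<in> rigid_stabilizer v" and h: "h \<in> rigid_stabilizer w"
  shows "g \<otimes> h = h \<otimes> g"
proof (rule act_faithful)
  have C: "g \<in> carrier G" "h \<in> carrier G" using g h rist_carrier by auto
  then show "g \<otimes> h \<in> carrier G" "h \<otimes> g \<in> carrier G" by auto
  fix u assume u: "u \<in> V"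
  have fg: "\<phi> g x = x" if "x \<in> V" "x \<notin> subtree E v" for x using g that by (simp add: rigid_stabilizer_def)
  have fh: "\<phi> h x = x" if "x \<in> V" "x \<notin> subtree E w" for x using h that by (simp add: rigid_stabilizer_def)
  show "\<phi> (g \<otimes> h) u = \<phi> (h \<otimes> g) u"
  proof (cases "u \<in> subtree E v")
    case True
    then have "u \<notin> subtree E w" using subtree_disjoint v w vw by blast
    moreover have "\<phi> g u \<notin> subtree E w"
      using True rist_preserves_subtree[OF g u] subtree_disjoint v w vw by blast
    ultimately show ?thesis using C u fh act_closed by (simp add: act_mult)
  next
    case False
    have "\<phi> h u \<notin> subtree E v"
    proof
      assume *: "\<phi> h u \<in> subtree E v"
      then have "\<phi> h u \<notin> subtree E w" using subtree_disjoint v w vw by blast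
      then have "\<phi> h u = u" using rist_preserves_subtree[OF h u] fh u by blast
      then show False using * False by simp
    qed
    then show ?thesis using C u fg False act_closed by (simp add: act_mult)
  qed
qed

lemma rist_Int_trivial:
  assumes v: "v \<in> level E r n" and w: "w \<in> level E r n" and vw: "v \<noteq> w"
    and g: "g \<in> rigid_stabilizer v" "g \<in> rigid_stabilizer w"
  shows "g = \<one>"
proof (rule act_faithful)
  fix u assume u: "u \<in> V"
  have "u \<notin> subtree E v \<or> u \<notin> subtree E w" using subtree_disjoint v w vw by blast
  then show "\<phi> g u = \<phi> \<one> u" using g u act_one by (auto simp: rigid_stabilizer_def)
qed (use g rist_carrier in auto)

lemma rist_nontrivial:
  assumes "v \<in> V"
  shows "\<exists>g \<in> rigid_stabilizer v. g \<noteq> \<one>"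
proof -
  obtain g w where g: "g \<in> carrier G" "w \<in> subtree E v" "\<phi> g w \<noteq> w"
    "\<forall>w \<in> V - subtree E v. \<phi> g w = w"
    using weakly_branch[OF assms] by blast
  have "w \<in> V" using g(2) relpow_in_V assms by (auto simp: subtree_iff)
  then have "g \<noteq> \<one>" using g(3) act_one by auto
  then show ?thesis using g by (auto simp: rigid_stabilizer_def)
qed

lemma moves_vertex_of_level:
  assumes "g \<in> carrier G" "h \<in> carrier G" "g \<noteq> h"
  obtains w n where "w \<in> level E r n" "w \<in> V" "\<phi> g w \<noteq> \<phi> h w"
  using act_faithful[OF assms(1,2)] in_some_level assms(3) by blast

text \<open>
  An element of the rigid stabilizer of a leaf could move only the leaf, and has nowhere to move it to.
\<close>

lemma has_child:
  assumes v: "v \<in> V"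
  shows "\<exists>w. (v, w) \<in> E"
proof (rule ccontr)
  assume no: "\<not> ?thesis"
  have "subtree E v = {v}"
    unfolding subtree_def using no by (auto elim: converse_rtranclE)
  obtain g where g: "g \<in> rigid_stabilizer v" "g \<noteq> \<one>" using rist_nontrivial[OF v] by blast
  have "\<phi> g u = u" if "u \<in> V" for u
  proof (cases "u = v")
    case True
    have "\<phi> g v \<in> subtree E v" using rist_preserves_subtree[OF g(1) v] self_in_subtree by blast
    then show ?thesis using True \<open>subtree E v = {v}\<close> by simp
  next
    case False
    then show ?thesis using g(1) that \<open>subtree E v = {v}\<close> by (simp add: rigid_stabilizer_def)
  qed
  then have "g = \<one>" using g(1) by (intro act_faithful) (auto simp: act_one rist_carrier)
  then show False using g(2) by simp
qed

lemma has_descendant: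
  assumes v: "v \<in> V"
  shows "\<exists>w. (v, w) \<in> E ^^ k"
proof (induction k)
  case (Suc k)
  then obtain w where "(v, w) \<in> E ^^ k" by blast
  then show ?case using has_child relpow_in_V v by (metis relpow_Suc_I)
qed auto

text \<open>
  Fixing all levels up to \<open>m\<close>, instead of level \<open>m\<close> alone, makes antitonicity in \<open>m\<close> immediate.
\<close>

definition level_stabilizer :: "nat \<Rightarrow> 'a set" where
  "level_stabilizer m = {g \<in> carrier G. \<forall>v \<in> (\<Union>i \<le> m. level E r i). \<phi> g v = v}"

lemma level_stabilizer_subgroup: "subgroup (level_stabilizer m) G"
  unfolding level_stabilizer_def by (rule pointwise_fixer_subgroup) (use level_subset in auto)

lemma level_stabilizer_antimono: "m \<le> m' \<Longrightarrow> level_stabilizer m' \<subseteq> level_stabilizer m"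
  by (force simp: level_stabilizer_def)

lemma level_stabilizer_conj:
  assumes g: "g \<in> carrier G" and h: "h \<in> level_stabilizer m"
  shows "g \<otimes> h \<otimes> inv g \<in> level_stabilizer m"
proof -
  have hC: "h \<in> carrier G" using h by (simp add: level_stabilizer_def)
  have "\<phi> (g \<otimes> h \<otimes> inv g) v = v" if v: "i \<le> m" "v \<in> level E r i" for v i
  proof -
    have vV: "v \<in> V" using v(2) level_subset by blast
    have "\<phi> (inv g) v \<in> level E r i" using act_level v(2) g by simp
    then have "\<phi> h (\<phi> (inv g) v) = \<phi> (inv g) v" using h v(1) by (auto simp: level_stabilizer_def)
    then show ?thesis using g hC vV by (simp add: act_mult act_closed act_inv)
  qed
  then show ?thesis using g hC by (auto simp: level_stabilizer_def)
qed

lemma rist_le_level_stabilizer: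
  assumes "v \<in> level E r n" "m < n"
  shows "rigid_stabilizer v \<subseteq> level_stabilizer m"
proof
  fix g assume g: "g \<in> rigid_stabilizer v"
  have "w \<notin> subtree E v" if "i \<le> m" "w \<in> level E r i" for w i
    using subtree_level(1)[OF assms(1), of w i] that assms(2) by auto
  then show "g \<in> level_stabilizer m"
    using g level_subset unfolding level_stabilizer_def rigid_stabilizer_def by blast
qed

text \<open>
  Rigid stabilizers are infinite, since they contain nontrivial elements that fix arbitrarily
  many levels (those of deep descendants); so they cannot embed into a finite set of cosets.
\<close>

lemma rist_meets_finite_index:
  assumes v: "v \<in> V" and H: "subgroup H G" and fin: "finite (rcosets H)"
  shows "\<exists>g \<in> rigid_stabilizer v \<inter> H. g \<noteq> \<one>"
proof (rule ccontr)
  assume no: "\<not> ?thesis"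
  have "inj_on (\<lambda>g. H #> g) (rigid_stabilizer v)"
  proof (rule inj_onI)
    fix g h assume gh: "g \<in> rigid_stabilizer v" "h \<in> rigid_stabilizer v" "H #> g = H #> h"
    have C: "g \<in> carrier G" "h \<in> carrier G" using gh rist_carrier by auto
    have "g \<otimes> inv h \<in> H" using gh C H by (simp add: rcos_eq_iff)
    moreover have "g \<otimes> inv h \<in> rigid_stabilizer v"
      using gh rist_subgroup subgroup.m_closed subgroup.m_inv_closed by metis
    ultimately have "g \<otimes> inv h = \<one>" using no by blast
    then have "g \<otimes> inv h \<otimes> h = h" using C by simp
    then show "g = h" using C by (simp add: cancel_inv_right)
  qed
  moreover have "(\<lambda>g. H #> g) ` rigid_stabilizer v \<subseteq> rcosets H"
    using rist_carrier by (auto simp: RCOSETS_def)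
  ultimately have finR: "finite (rigid_stabilizer v)" using fin by (meson finite_imageD finite_subset)
  have "\<exists>n. g \<notin> level_stabilizer n" if g: "g \<in> rigid_stabilizer v - {\<one>}" for g
  proof -
    obtain w n where "w \<in> level E r n" "w \<in> V" "\<phi> g w \<noteq> \<phi> \<one> w"
      using moves_vertex_of_level[of g \<one>] g rist_carrier one_closed by blast
    then have "g \<notin> level_stabilizer n" by (auto simp: level_stabilizer_def act_one)
    then show ?thesis by blast
  qed
  then obtain d where d: "\<And>g. g \<in> rigid_stabilizer v - {\<one>} \<Longrightarrow> g \<notin> level_stabilizer (d g)" by metis
  define M where "M = Max (insert 0 (d ` (rigid_stabilizer v - {\<one>})))"
  have M: "d g \<le> M" if "g \<in> rigid_stabilizer v - {\<one>}" for g
    unfolding M_def using finR that by (intro Max_ge) auto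
  obtain l where l: "v \<in> level E r l" using in_some_level[OF v] by blast
  obtain w where w: "(v, w) \<in> E ^^ Suc M" using has_descendant[OF v] by blast
  have wl: "w \<in> level E r (l + Suc M)" using l w by (auto simp: level_iff relpow_add)
  obtain g where g: "g \<in> rigid_stabilizer w" "g \<noteq> \<one>"
    using rist_nontrivial relpow_in_V[OF w v] by blast
  have "w \<in> subtree E v" using w unfolding subtree_iff by blast
  then have "g \<in> rigid_stabilizer v - {\<one>}" using rist_mono g by blast
  moreover have "g \<in> level_stabilizer M" using rist_le_level_stabilizer[OF wl, of M] g by auto
  ultimately show False using d M level_stabilizer_antimono by blast
qed

end

section \<open>The filtration of a weakly branch group\<close>

locale weakly_branch_group_auto = weakly_branch_group V E r G \<phi>
  for V :: "'v set" and E and r and G :: "('a, 'b) monoid_scheme" (structure) and \<phi> +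
  fixes \<psi> :: "'a \<Rightarrow> 'a" and n :: nat and c :: 'a
  assumes finite_levels: "finite (level E r i)"
    and auto: "\<psi> \<in> auto G" and n: "0 < n" and c: "c \<in> carrier G"
    and inner: "g \<in> carrier G \<Longrightarrow> (\<psi> ^^ n) g = c \<otimes> g \<otimes> inv c"
begin

lemma funpow_auto_hom: "group_hom G G (\<psi> ^^ i)"
proof (induction i)
  case 0
  then show ?case by unfold_locales (auto simp: hom_def)
next
  case (Suc i)
  then have "\<psi> \<circ> (\<psi> ^^ i) \<in> hom G G"
    using auto Group.hom_compose[of "\<psi> ^^ i" G G \<psi> G] group_hom.homh by (auto simp: auto_def)
  moreover have "\<psi> ^^ Suc i = \<psi> \<circ> (\<psi> ^^ i)" by simp
  ultimately show ?case by unfold_locales metis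
qed

text \<open>
  Level stabilizers need not be invariant under \<open>\<psi>\<close>; this is the largest subgroup of the level stabilizer
  that is mapped into itself.
\<close>

definition core :: "nat \<Rightarrow> 'a set" where
  "core m = {g \<in> carrier G. \<forall>i. (\<psi> ^^ i) g \<in> level_stabilizer m}"

text \<open>
  Only \<open>n\<close> conditions matter, since \<open>\<psi> ^^ n\<close> is inner and level stabilizers are normal. This is why
  the core has finite index.
\<close>

lemma coreI:
  assumes g: "g \<in> carrier G" and i: "\<And>i. i < n \<Longrightarrow> (\<psi> ^^ i) g \<in> level_stabilizer m"
  shows "g \<in> core m"
proof -
  have "(\<psi> ^^ i) g \<in> level_stabilizer m" for i
  proof (induction i rule: less_induct)
    case (less i)
    show ?case
    proof (cases "i < n")
      case False
      then have "(\<psi> ^^ i) g = (\<psi> ^^ n) ((\<psi> ^^ (i - n)) g)"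
        by (metis funpow_add comp_apply le_add_diff_inverse not_less)
      also have "\<dots> = c \<otimes> (\<psi> ^^ (i - n)) g \<otimes> inv c"
        using inner group_hom.hom_closed[OF funpow_auto_hom g] by blast
      finally show ?thesis using less[of "i - n"] False n level_stabilizer_conj[OF c] by simp
    qed (use i in simp)
  qed
  then show ?thesis using g by (simp add: core_def)
qed

lemma core_le: "core m \<subseteq> level_stabilizer m"
proof
  fix g assume "g \<in> core m"
  then have "(\<psi> ^^ 0) g \<in> level_stabilizer m" unfolding core_def by blast
  then show "g \<in> level_stabilizer m" by simp
qed

lemma core_normal: "core m \<lhd> G"
proof -
  have "subgroup (core m) G"
  proof (rule subgroupI)
    have "\<one> \<in> core m"
      using group_hom.hom_one[OF funpow_auto_hom] subgroup.one_closed[OF level_stabilizer_subgroup]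
      by (simp add: core_def)
    then show "core m \<noteq> {}" by blast
    fix g assume "g \<in> core m"
    then show "inv g \<in> core m"
      using group_hom.hom_inv[OF funpow_auto_hom] subgroup.m_inv_closed[OF level_stabilizer_subgroup]
      by (simp add: core_def)
  next
    fix g h assume "g \<in> core m" "h \<in> core m"
    then show "g \<otimes> h \<in> core m"
      using group_hom.hom_mult[OF funpow_auto_hom] subgroup.m_closed[OF level_stabilizer_subgroup]
      by (simp add: core_def)
  qed (auto simp: core_def)
  moreover have "g \<otimes> h \<otimes> inv g \<in> core m" if g: "g \<in> carrier G" and h: "h \<in> core m" for g h
  proof -
    have hC: "h \<in> carrier G" using h by (simp add: core_def)
    have "(\<psi> ^^ i) (g \<otimes> h \<otimes> inv g) \<in> level_stabilizer m" for i
    proof -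
      interpret i: group_hom G G "\<psi> ^^ i" by (rule funpow_auto_hom)
      have "(\<psi> ^^ i) (g \<otimes> h \<otimes> inv g) = (\<psi> ^^ i) g \<otimes> (\<psi> ^^ i) h \<otimes> inv ((\<psi> ^^ i) g)"
        using g hC by simp
      then show ?thesis using level_stabilizer_conj[of "(\<psi> ^^ i) g"] g h by (simp add: core_def)
    qed
    then show ?thesis using g hC by (simp add: core_def)
  qed
  ultimately show ?thesis by (intro normal_invI)
qed

lemma core_invariant: "\<psi> ` core m = core m"
proof
  show "\<psi> ` core m \<subseteq> core m"
  proof
    fix g assume "g \<in> \<psi> ` core m"
    then obtain h where h: "h \<in> core m" "g = \<psi> h" by blast
    have "(\<psi> ^^ Suc i) h \<in> level_stabilizer m" for i using h(1) unfolding core_def by blast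
    then have "(\<psi> ^^ i) g \<in> level_stabilizer m" for i
      unfolding h(2) by (simp add: funpow_swap1)
    moreover have "g \<in> carrier G" using h auto by (simp add: core_def auto_closed)
    ultimately show "g \<in> core m" by (simp add: core_def)
  qed
  show "core m \<subseteq> \<psi> ` core m"
  proof
    fix g assume g: "g \<in> core m"
    then have "g \<in> carrier G" by (simp add: core_def)
    moreover have "\<psi> ` carrier G = carrier G" using auto by (auto simp: auto_def Bij_def bij_betw_def)
    ultimately obtain h where h: "h \<in> carrier G" "g = \<psi> h" by blast
    have shift: "(\<psi> ^^ Suc i) h \<in> level_stabilizer m" for i
      using g unfolding core_def h(2) by (simp add: funpow_swap1)
    have "c \<otimes> h \<otimes> inv c \<in> level_stabilizer m"
      using shift[of "n - 1"] inner[OF h(1)] n by (simp del: funpow.simps)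
    then have "inv c \<otimes> (c \<otimes> h \<otimes> inv c) \<otimes> inv (inv c) \<in> level_stabilizer m"
      using level_stabilizer_conj c by blast
    then have "h \<in> level_stabilizer m" using c h(1) by (simp add: group_simps)
    then have "(\<psi> ^^ i) h \<in> level_stabilizer m" for i
      using shift[of "i - 1"] by (cases i) auto
    then show "g \<in> \<psi> ` core m" using h by (auto simp: core_def)
  qed
qed

text \<open>
  The coset of \<open>g\<close> is determined by the action of finitely many elements \<open>(\<psi> ^^ i) g\<close> on a finite set
  of vertices.
\<close>

lemma core_finite_index: "finite (rcosets (core m))"
proof -
  define L where "L = (\<Union>i \<le> m. level E r i)"
  have L: "finite L" unfolding L_def using finite_levels by blast
  have LV: "L \<subseteq> V" unfolding L_def using level_subset by blast
  define f where "f g = (\<lambda>i \<in> {..<n}. \<lambda>v \<in> L. \<phi> ((\<psi> ^^ i) g) v)" for g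
  have fC: "(\<psi> ^^ i) g \<in> carrier G" if "g \<in> carrier G" for g i
    using group_hom.hom_closed[OF funpow_auto_hom that] .
  have "f ` carrier G \<subseteq> {..<n} \<rightarrow>\<^sub>E (L \<rightarrow>\<^sub>E L)"
    unfolding f_def L_def using fC act_level by fastforce
  moreover have "finite ({..<n} \<rightarrow>\<^sub>E (L \<rightarrow>\<^sub>E L))" using L by (intro finite_PiE) auto
  ultimately have fin: "finite (f ` carrier G)" using finite_subset by blast
  have eq: "core m #> g = core m #> h"
    if gh: "g \<in> carrier G" "h \<in> carrier G" "f g = f h" for g h
  proof -
    have "(\<psi> ^^ i) (g \<otimes> inv h) \<in> level_stabilizer m" if i: "i < n" for i
    proof -
      interpret i: group_hom G G "\<psi> ^^ i" by (rule funpow_auto_hom)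
      have "\<phi> ((\<psi> ^^ i) g \<otimes> inv ((\<psi> ^^ i) h)) v = v" if v: "v \<in> L" for v
      proof -
        have vV: "v \<in> V" using v LV by blast
        define w where "w = \<phi> (inv ((\<psi> ^^ i) h)) v"
        have "w \<in> L" using v act_level[of "inv ((\<psi> ^^ i) h)" v] gh(2) unfolding w_def L_def by auto
        then have "\<phi> ((\<psi> ^^ i) g) w = \<phi> ((\<psi> ^^ i) h) w"
          using fun_cong[OF fun_cong[OF gh(3), of i], of w] i by (simp add: f_def)
        also have "\<dots> = v" unfolding w_def using act_inv gh(2) vV by simp
        finally show ?thesis unfolding w_def using act_mult gh vV by simp
      qed
      moreover have "(\<psi> ^^ i) (g \<otimes> inv h) = (\<psi> ^^ i) g \<otimes> inv ((\<psi> ^^ i) h)" using gh by simp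
      ultimately show ?thesis using gh(1,2) unfolding level_stabilizer_def L_def by auto
    qed
    then have "g \<otimes> inv h \<in> core m" using gh by (intro coreI) auto
    then show ?thesis using gh core_normal by (simp add: rcos_eq_iff normal_imp_subgroup)
  qed
  have "rcosets (core m) \<subseteq> (\<lambda>y. core m #> inv_into (carrier G) f y) ` f ` carrier G"
  proof
    fix C assume "C \<in> rcosets (core m)"
    then obtain g where g: "g \<in> carrier G" "C = core m #> g" by (auto simp: RCOSETS_def)
    then have "C = core m #> inv_into (carrier G) f (f g)"
      using eq[OF g(1) inv_into_into[of "f g" f "carrier G"]] f_inv_into_f[of "f g" f "carrier G"]
      by simp
    then show "C \<in> (\<lambda>y. core m #> inv_into (carrier G) f y) ` f ` carrier G" using g(1) by blast
  qed
  then show ?thesis using fin finite_subset by blast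
qed

sublocale filtered_group G core
proof (intro filtered_group.intro filtered_group_axioms.intro group_axioms core_normal)
  show "core m' \<subseteq> core m" if "m \<le> m'" for m m'
    using level_stabilizer_antimono[OF that] unfolding core_def by blast
qed

text \<open>
  If \<open>u\<close> moves a vertex \<open>x\<close>, it moves the rigid stabilizer of \<open>x\<close> to one that intersects it trivially.
\<close>

lemma rist_core_centerless:
  assumes w: "w \<in> V" and u: "u \<in> rigid_stabilizer w \<inter> core m" "u \<noteq> \<one>"
  shows "\<exists>v \<in> rigid_stabilizer w \<inter> core m. u \<otimes> v \<noteq> v \<otimes> u"
proof -
  have uC: "u \<in> carrier G" using u rist_carrier by blast
  obtain x l where x: "x \<in> level E r l" "x \<in> V" "\<phi> u x \<noteq> \<phi> \<one> x"
    using moves_vertex_of_level[OF uC one_closed u(2)] by blast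
  have xw: "x \<in> subtree E w" using u x act_one by (auto simp: rigid_stabilizer_def)
  obtain v where v: "v \<in> rigid_stabilizer x" "v \<in> core m" "v \<noteq> \<one>"
    using rist_meets_finite_index[OF x(2) K_subgroup core_finite_index] by blast
  have vC: "v \<in> carrier G" using v rist_carrier by blast
  have "u \<otimes> v \<noteq> v \<otimes> u"
  proof
    assume "u \<otimes> v = v \<otimes> u"
    then have "u \<otimes> v \<otimes> inv u = v" using uC vC by (simp add: cancel_inv_right)
    then have "v \<in> rigid_stabilizer (\<phi> u x)" using rist_conj[OF uC x(2) v(1)] by simp
    then have "v = \<one>"
      using rist_Int_trivial[OF act_level[OF uC x(1)] x(1) _ _ v(1)] x(2,3) act_one by simp
    then show False using v(3) by simp
  qed
  then show ?thesis using v rist_mono[OF xw] by blast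
qed

lemma rist_core_local:
  assumes w: "w \<in> level E r l" "l \<le> m"
  shows "local_subgroup m (rigid_stabilizer w \<inter> core m)"
proof -
  have wV: "w \<in> V" using w(1) level_subset by blast
  have "k \<otimes> a \<otimes> inv k \<in> rigid_stabilizer w \<inter> core m" if k: "k \<in> core m" and a: "a \<in> rigid_stabilizer w \<inter> core m" for k a
  proof -
    have kC: "k \<in> carrier G" using k by (rule K_carrier)
    have "\<phi> k w = w" using k core_le[of m] w by (auto simp: level_stabilizer_def)
    then show ?thesis using rist_conj[OF kC wV, of a] a K_conj[OF kC, of a m] by simp
  qed
  moreover have "subgroup (rigid_stabilizer w \<inter> core m) G"
    using subgroups_Inter_pair[OF rist_subgroup K_subgroup] .
  moreover have "rigid_stabilizer w \<inter> core m \<noteq> {\<one>}"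
    using rist_meets_finite_index[OF wV K_subgroup core_finite_index, of m] by blast
  ultimately show ?thesis by (auto simp: local_subgroup_def normalized_by_def)
qed

sublocale separated_filtered_group G core
proof
  show "carrier G \<noteq> {\<one>}" using rist_nontrivial[OF root_in] rist_carrier by blast
  fix a b :: 'a and M :: nat
  assume ab: "a \<in> carrier G" "b \<in> carrier G" "a \<noteq> b"
  obtain w l where w: "w \<in> level E r l" "w \<in> V" "\<phi> a w \<noteq> \<phi> b w"
    using moves_vertex_of_level[OF ab] by blast
  define m where "m = max M l"
  define R where "R = rigid_stabilizer w \<inter> core m"
  have conj: "conj_set G g R \<subseteq> rigid_stabilizer (\<phi> g w)" if "g \<in> carrier G" for g
    using rist_conj[OF that w(2)] unfolding R_def conj_set_def by blast
  have comm: "elementwise_commute G A B"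
    if "x \<in> level E r l" "y \<in> level E r l" "x \<noteq> y" "A \<subseteq> rigid_stabilizer x" "B \<subseteq> rigid_stabilizer y" for x y A B
    unfolding elementwise_commute_def using rist_commute[OF that(1-3)] that(4,5) by blast
  have Rw: "R \<subseteq> rigid_stabilizer w" by (simp add: R_def)
  note lev = act_level[OF ab(1) w(1)] act_level[OF ab(2) w(1)]
  have "elementwise_commute G (conj_set G a R) R \<or> elementwise_commute G (conj_set G b R) R"
    using comm[OF lev(1) w(1) _ conj[OF ab(1)] Rw] comm[OF lev(2) w(1) _ conj[OF ab(2)] Rw] w(3)
    by metis
  moreover have "elementwise_commute G (conj_set G a R) (conj_set G b R)"
    using comm[OF lev w(3) conj[OF ab(1)] conj[OF ab(2)]] .
  moreover have "local_subgroup m R"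
    unfolding R_def using rist_core_local[OF w(1)] by (simp add: m_def)
  moreover have "\<forall>u \<in> R. u \<noteq> \<one> \<longrightarrow> (\<exists>v \<in> R. u \<otimes> v \<noteq> v \<otimes> u)"
    unfolding R_def using rist_core_centerless[OF w(2)] by blast
  moreover have "m \<ge> M" by (simp add: m_def)
  ultimately show "\<exists>m \<ge> M. \<exists>R. local_subgroup m R \<and>
        (\<forall>u \<in> R. u \<noteq> \<one> \<longrightarrow> (\<exists>v \<in> R. u \<otimes> v \<noteq> v \<otimes> u)) \<and>
        elementwise_commute G (conj_set G a R) (conj_set G b R) \<and>
        (elementwise_commute G (conj_set G a R) R \<or> elementwise_commute G (conj_set G b R) R)"
    by blast
qed

lemma infinite_reidemeister: "infinite (carrier G // twisted_conj G \<psi>)"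
proof (rule infinitely_many_twisted_classes[OF auto core_invariant core_finite_index _ n c inner])
  fix g assume g: "\<And>m. g \<in> core m"
  have gC: "g \<in> carrier G" using g by (rule K_carrier)
  show "g = \<one>"
  proof (rule ccontr)
    assume "g \<noteq> \<one>"
    then obtain w l where "w \<in> level E r l" "w \<in> V" "\<phi> g w \<noteq> \<phi> \<one> w"
      using moves_vertex_of_level[OF gC one_closed] by blast
    then show False using g[of l] core_le[of l] act_one by (auto simp: level_stabilizer_def)
  qed
qed

end

section \<open>The property \<open>R\<^sub>\<infinity>\<close>\<close>

lemma (in group) finite_order_in_Out:
  assumes \<psi>: "\<psi> \<in> auto G"
    and pow: "(inner_automorphisms G #>\<^bsub>AutoGroup G\<^esub> \<psi>) [^]\<^bsub>OutGroup G\<^esub> n = \<one>\<^bsub>OutGroup G\<^esub>"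
  shows "\<exists>c \<in> carrier G. \<forall>g \<in> carrier G. (\<psi> ^^ n) g = c \<otimes> g \<otimes> inv c"
proof -
  interpret A: group "AutoGroup G" by (rule AutoGroup)
  interpret I: normal "inner_automorphisms G" "AutoGroup G" by (rule inner_automorphisms_normal)
  have \<psi>A: "\<psi> \<in> carrier (AutoGroup G)" using \<psi> by (simp add: AutoGroup_simps)
  have "inner_automorphisms G #>\<^bsub>AutoGroup G\<^esub> (\<psi> [^]\<^bsub>AutoGroup G\<^esub> n) = inner_automorphisms G"
    using pow I.FactGroup_pow[OF \<psi>A, of n] by (simp add: OutGroup_def)
  then have "\<psi> [^]\<^bsub>AutoGroup G\<^esub> n \<in> inner_automorphisms G"
    using A.coset_join1[OF _ A.nat_pow_closed[OF \<psi>A] I.subgroup_axioms] I.subset by blast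
  then obtain c where c: "c \<in> carrier G"
    "\<psi> [^]\<^bsub>AutoGroup G\<^esub> n = (\<lambda>x \<in> carrier G. c \<otimes> x \<otimes> inv c)"
    by (auto simp: inner_automorphisms_def)
  have pow_eq: "(\<psi> [^]\<^bsub>AutoGroup G\<^esub> i) g = (\<psi> ^^ i) g" if "g \<in> carrier G" for g i
    using that
  proof (induction i arbitrary: g)
    case 0
    then show ?case by (simp add: AutoGroup_simps)
  next
    case (Suc i)
    have "\<psi> [^]\<^bsub>AutoGroup G\<^esub> i \<in> auto G"
      using A.nat_pow_closed[OF \<psi>A, of i] by (simp only: AutoGroup_simps)
    then show ?case
      using Suc \<psi> by (simp add: AutoGroup_simps compose_eq auto_closed funpow_swap1)
  qed
  have "(\<psi> ^^ n) g = c \<otimes> g \<otimes> inv c" if "g \<in> carrier G" for g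
    using pow_eq[OF that, of n] that unfolding c(2) by simp
  then show ?thesis using c(1) by blast
qed

theorem theorem2p2:
  fixes V :: "'v set" and E :: "('v \<times> 'v) set" and r :: 'v
    and G :: "('a, 'b) monoid_scheme" and \<phi> :: "'a \<Rightarrow> 'v \<Rightarrow> 'v"
  assumes "spherically_symmetric_tree V E r"
    and "weakly_branch_group V E r G \<phi>"
    and "saturated E r G \<phi>"
    and "\<forall>x \<in> carrier (OutGroup G). \<exists>n::nat. 0 < n \<and> x [^]\<^bsub>OutGroup G\<^esub> n = \<one>\<^bsub>OutGroup G\<^esub>"
  shows "R_infinity G"
  unfolding R_infinity_def
proof
  fix \<psi> assume \<psi>: "\<psi> \<in> auto G"
  interpret W: weakly_branch_group V E r G \<phi> by (rule assms(2))
  have "inner_automorphisms G #>\<^bsub>AutoGroup G\<^esub> \<psi> \<in> carrier (OutGroup G)"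
    unfolding OutGroup_def carrier_FactGroup using \<psi> by (auto simp: W.AutoGroup_simps)
  then obtain n :: nat where n: "0 < n"
    "(inner_automorphisms G #>\<^bsub>AutoGroup G\<^esub> \<psi>) [^]\<^bsub>OutGroup G\<^esub> n = \<one>\<^bsub>OutGroup G\<^esub>"
    using assms(4) by blast
  from W.finite_order_in_Out[OF \<psi> n(2)]
  obtain c where c: "c \<in> carrier G"
    "\<And>g. g \<in> carrier G \<Longrightarrow> (\<psi> ^^ n) g = c \<otimes>\<^bsub>G\<^esub> g \<otimes>\<^bsub>G\<^esub> inv\<^bsub>G\<^esub> c" by blast
  interpret weakly_branch_group_auto V E r G \<phi> \<psi> n c
    using spherically_symmetric_tree.finite_level[OF assms(1)] \<psi> n(1) c
    by unfold_locales auto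
  show "reidemeister_number G \<psi> = \<infinity>"
    using infinite_reidemeister by (simp add: reidemeister_number_def Let_def)
qed

end
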